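(* Let $\phi^{(1)}\in\mathcal{S}(\mathbb{R})$ and $\phi^{(2)}\in\mathcal{S}(\mathbb{R}^2)$ be as specified in the context, and let $$\mathcal{K}(x_1,x_2,x_3)=\sum_{j,k\in\mathbb{Z}}2^{2j+2k}\phi^{(1)}(2^jx_1)\,\phi^{(2)}(2^kx_2,2^{j+k}x_3),\qquad x_1x_2x_3\ne0.$$ Then the following hold. (1) $$|\partial_{x_1}^\alpha\partial_{x_2}^\beta\partial_{x_3}^\gamma\mathcal{K}(x_1,x_2,x_3)|\le\frac{C_{\alpha,\beta,\gamma,\theta_2}}{|x_1|^{\alpha+1}|x_2|^{\beta+1}|x_3|^{\gamma+1}}\Big(\Big|\frac{x_1x_2}{x_3}\Big|+\Big|\frac{x_3}{x_1x_2}\Big|\Big)^{-\theta_2}$$ for all integers $\alpha,\beta,\gamma\ge0$ and all $0<\theta_2<1$; (2) $$\Big|\int_{\delta_1\le|x_1|\le r_1}\int_{\delta_2\le|x_2|\le r_2}\int_{\delta_3\le|x_3|\le r_3}\mathcal{K}(x_1,x_2,x_3)\,dx_1dx_2dx_3\Big|\le C$$ uniformly for all $\delta_1,\delta_2,\delta_3,r_1,r_2,r_3>0$; (3) $$\Big|\int_{\delta\le|x_1|\le r}\partial_{x_2}^\beta\partial_{x_3}^\gamma\mathcal{K}(x_1,x_2,x_3)\,dx_1\Big|\le\frac{C_{\beta,\gamma,\theta_2}}{|x_2|^{\beta+1}|x_3|^{\gamma+1}}\bigg(\frac{1}{\big(|\frac{rx_2}{x_3}|+|\frac{x_3}{rx_2}|\big)^{\theta_2}}+\frac{1}{\big(|\frac{\delta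 x_2}{x_3}|+|\frac{x_3}{\delta x_2}|\big)^{\theta_2}}\bigg)$$ for all $\delta,r>0$, all integers $\beta,\gamma\ge0$ and all $0<\theta_2<1$; (4) $$\Big|\int_{\delta_1\le|x_2|\le r_1}\int_{\delta_2\le|x_3|\le r_2}\partial_{x_1}^\alpha\mathcal{K}(x_1,x_2,x_3)\,dx_2dx_3\Big|\le\frac{C_\alpha}{|x_1|^{\alpha+1}}$$ uniformly for all $\delta_1,\delta_2,r_1,r_2>0$ and all integers $\alpha\ge0$.
   Context: The functions $\phi^{(1)}\in\mathcal{S}(\mathbb{R})$ and $\phi^{(2)}\in\mathcal{S}(\mathbb{R}^2)$ (Schwartz functions) are fixed (constants may depend on them), are supported in the unit balls centered at the origin, and satisfy: $\sum_{j\in\mathbb{Z}}|\widehat{\phi^{(1)}}(2^j\xi_1)|^2=1$ for all $\xi_1\in\mathbb{R}\setminus\{0\}$; $\sum_{k\in\mathbb{Z}}|\widehat{\phi^{(2)}}(2^k\xi_2,2^k\xi_3)|^2=1$ for all $(\xi_2,\xi_3)\in\mathbb{R}^2\setminus\{(0,0)\}$; and the moment conditions $\int_{\mathbb{R}}x_1^\alpha\phi^{(1)}(x_1)\,dx_1=\int_{\mathbb{R}^2}x_2^\beta x_3^\gamma\phi^{(2)}(x_2,x_3)\,dx_2dx_3=0$ for all integers $0\le\alpha,\beta,\gamma\le10$. *)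

theory Defs
  imports "HOL-Analysis.Analysis"
begin

definition partial_deriv ::
    "'a::real_normed_vector \<Rightarrow> ('a \<Rightarrow> 'b::real_normed_vector) \<Rightarrow> 'a \<Rightarrow> 'b" where
  "partial_deriv v f x = vector_derivative (\<lambda>t. f (x + t *\<^sub>R v)) (at 0)"

text \<open>
  The next notion is \<open>C\<^sup>\<infinity>\<close> regularity, intended for open \<open>S\<close>: every iterated partial derivative of
  \<open>f\<close>, in any order of the coordinate directions, is (Frechet) differentiable on \<open>S\<close>.
\<close>

definition smooth_on :: "'a::euclidean_space set \<Rightarrow> ('a \<Rightarrow> 'b::real_normed_vector) \<Rightarrow> bool" where
  "smooth_on S f \<longleftrightarrow> (\<forall>vs. set vs \<subseteq> Basis \<longrightarrow> foldr partial_deriv vs f differentiable_on S)"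

definition schwartz :: "('a::euclidean_space \<Rightarrow> complex) \<Rightarrow> bool" where
  "schwartz f \<longleftrightarrow> smooth_on UNIV f \<and>
     (\<forall>n vs. set vs \<subseteq> Basis \<longrightarrow> bounded (range (\<lambda>x. norm x ^ n *\<^sub>R foldr partial_deriv vs f x)))"

definition fourier :: "('a::euclidean_space \<Rightarrow> complex) \<Rightarrow> 'a \<Rightarrow> complex" where
  "fourier f \<xi> = (LINT x|lborel. f x * cis (- 2 * pi * (x \<bullet> \<xi>)))"

definition dyadic_term ::
    "(real \<Rightarrow> complex) \<Rightarrow> (real \<times> real \<Rightarrow> complex) \<Rightarrow> real \<times> real \<times> real \<Rightarrow> int \<times> int \<Rightarrow> complex" where
  "dyadic_term \<phi>1 \<phi>2 = (\<lambda>(x1, x2, x3) (j, k).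
     2 powi (2 * j + 2 * k) * \<phi>1 (2 powi j * x1) * \<phi>2 (2 powi k * x2, 2 powi (j + k) * x3))"

text \<open>
  The kernel is only meaningful where \<open>x1 * x2 * x3 \<noteq> 0\<close>; elsewhere the sum may diverge, and its
  value is then the default one of \<^const>\<open>infsum\<close>.
\<close>

definition dyadic_kernel ::
    "(real \<Rightarrow> complex) \<Rightarrow> (real \<times> real \<Rightarrow> complex) \<Rightarrow> real \<times> real \<times> real \<Rightarrow> complex" where
  "dyadic_kernel \<phi>1 \<phi>2 x = (\<Sum>\<^sub>\<infinity>jk\<in>UNIV. dyadic_term \<phi>1 \<phi>2 x jk)"

definition partial3 ::
    "nat \<Rightarrow> nat \<Rightarrow> nat \<Rightarrow> (real \<times> real \<times> real \<Rightarrow> complex) \<Rightarrow> real \<times> real \<times> real \<Rightarrow> complex" where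
  "partial3 \<alpha> \<beta> \<gamma> f =
     (partial_deriv (1, 0, 0) ^^ \<alpha>) ((partial_deriv (0, 1, 0) ^^ \<beta>) ((partial_deriv (0, 0, 1) ^^ \<gamma>) f))"

definition shell :: "real \<Rightarrow> real \<Rightarrow> real set" where
  "shell \<delta> r = {x. \<delta> \<le> \<bar>x\<bar> \<and> \<bar>x\<bar> \<le> r}"

end

theory Submission
  imports Defs
begin

text \<open>
  Write \<open>a = 2\<^sup>j\<close>, \<open>b = 2\<^sup>k\<close>.  The \<open>(j, k)\<close> term of the kernel is \<open>a\<^sup>2 b\<^sup>2\<close> times a dilated
  \<open>\<phi>1\<close> times a dilated \<open>\<phi>2\<close>, and by the support conditions it can only be nonzero when
  \<open>a \<bar>x1\<bar> \<le> 1\<close>, \<open>b \<bar>x2\<bar> \<le> 1\<close> and \<open>a b \<bar>x3\<bar> \<le> 1\<close>.  A derivative in \<open>x1\<close>, \<open>x2\<close>, \<open>x3\<close> multiplies the weight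
  by \<open>a\<close>, \<open>b\<close>, \<open>a b\<close> and differentiates one of the two bumps, so that every partial derivative of
  the kernel is again a sum of the same shape, with weights \<open>a\<^sup>m b\<^sup>n\<close> (\<open>multiscale_sum\<close>).  All
  series over the scales are dominated by products of geometric series that are cut off at the
  support conditions; this yields convergence, termwise differentiation
  (\<open>multiscale_sum_has_derivative\<close>) and termwise integration (\<open>norm_integral_infsum_le\<close>).

  The pointwise estimate comes from the support conditions.  After division by
  \<open>\<bar>x1\<bar>\<^bsup>-\<alpha>-1\<^esup> \<bar>x2\<bar>\<^bsup>-\<beta>-1\<^esup> \<bar>x3\<bar>\<^bsup>-\<gamma>-1\<^esup>\<close> a term is at most \<open>u v w\<close>, where \<open>u = a \<bar>x1\<bar>\<close>, \<open>v = b \<bar>x2\<bar>\<close> and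
  \<open>w = a b \<bar>x3\<bar>\<close> are at most 1 and \<open>w = u v R\<close> with \<open>R = \<bar>x3 / (x1 x2)\<bar>\<close>.  Interpolating between the
  bounds on \<open>u v\<close> and on \<open>w\<close> gives \<open>u v w \<le> 2 (R + 1/R)\<^bsup>-\<theta>\<^esup> (u v)\<^bsup>1-\<theta>\<^esup>\<close>
  (\<open>product_le_balanced_ratio\<close>), and since \<open>\<theta> < 1\<close> the last factor sums geometrically over both
  scales.

  The three integral estimates use in addition that the bumps have mean zero.  The integral of
  \<open>a \<phi>1(a x)\<close> over \<open>\<bar>x\<bar> \<le> t\<close> is at most a constant times \<open>a t\<close>, and it vanishes as soon as
  \<open>a t > 1\<close>, because the support is then covered.  A shell is a difference of two intervals, so the
  integral over it is small unless \<open>a\<close> is comparable to the reciprocal of one of its radii, and its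
  sum over \<open>j\<close> is bounded uniformly in the radii (\<open>shell_integral_le\<close>).  The same holds for the
  two-dimensional bump, rectangles and the sum over \<open>k\<close> (\<open>shell_integral_prod_le\<close>).  Integrating in
  \<open>x1\<close> alone, each radius \<open>t\<close> of the shell takes over the role of \<open>\<bar>x1\<bar>\<close> in the pointwise estimate,
  which is why the bound is a sum of one such contribution for each radius.
\<close>

section \<open>Sums over all dyadic scales\<close>

text \<open>
  Bounding all finite subsums gives summability and a value for the sum at once.  The constant is
  kept explicit because the estimates must be uniform in the points and radii.
\<close>

definition bounded_sum :: "('i \<Rightarrow> real) \<Rightarrow> real \<Rightarrow> bool" where
  "bounded_sum f C \<longleftrightarrow> (\<forall>i. 0 \<le> f i) \<and> (\<forall>F. finite F \<longrightarrow> sum f F \<le> C)"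

lemma bounded_sum_ge_0: "bounded_sum f C \<Longrightarrow> 0 \<le> f i"
  by (simp add: bounded_sum_def)

lemma bounded_sum_summable:
  assumes "bounded_sum f C"
  shows "f summable_on UNIV"
  by (rule nonneg_bdd_above_summable_on) (use assms in \<open>auto simp: bounded_sum_def intro!: bdd_aboveI\<close>)

lemma bounded_sum_infsum_le: "bounded_sum f C \<Longrightarrow> infsum f UNIV \<le> C"
  by (rule infsum_le_finite_sums) (auto simp: bounded_sum_summable bounded_sum_def)

lemma bounded_sum_nonneg: "bounded_sum f C \<Longrightarrow> 0 \<le> C"
  unfolding bounded_sum_def by (metis finite.emptyI sum.empty)

lemma bounded_sum_add:
  assumes "bounded_sum f C" "bounded_sum g D"
  shows "bounded_sum (\<lambda>i. f i + g i) (C + D)"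
  using assms unfolding bounded_sum_def by (auto simp: sum.distrib intro!: add_mono)

lemma bounded_sum_cmult:
  assumes "bounded_sum f C" "0 \<le> c"
  shows "bounded_sum (\<lambda>i. c * f i) (c * C)"
  using assms unfolding bounded_sum_def by (auto simp: sum_distrib_left[symmetric] intro!: mult_left_mono)

text \<open>
  The inner bound \<open>Q\<close> is uniform in \<open>j\<close>, but \<open>Y\<close> itself may depend on \<open>j\<close>: the third coordinate is
  dilated by \<open>2 powi (j + k)\<close>, so the sum over \<open>k\<close> sees a radius that moves with \<open>j\<close>.
\<close>

lemma bounded_sum_product:
  fixes X :: "'i \<Rightarrow> real" and Y :: "'i \<Rightarrow> 'k \<Rightarrow> real"
  assumes X: "bounded_sum X P" and Y: "\<And>j. bounded_sum (Y j) Q"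
  shows "bounded_sum (\<lambda>(j, k). X j * Y j k) (P * Q)"
  unfolding bounded_sum_def
proof (intro conjI allI impI)
  fix i show "0 \<le> (case i of (j, k) \<Rightarrow> X j * Y j k)"
    using X Y by (auto simp: bounded_sum_def split: prod.split)
next
  fix F :: "('i \<times> 'k) set" assume F: "finite F"
  have "sum (\<lambda>(j, k). X j * Y j k) F \<le> sum (\<lambda>(j, k). X j * Y j k) (fst ` F \<times> snd ` F)"
    by (rule sum_mono2) (use F X Y in \<open>auto simp: bounded_sum_def subset_fst_snd\<close>)
  also have "\<dots> = (\<Sum>j\<in>fst ` F. X j * (\<Sum>k\<in>snd ` F. Y j k))"
    by (simp add: sum.cartesian_product sum_distrib_left)
  also have "\<dots> \<le> (\<Sum>j\<in>fst ` F. X j * Q)"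
    by (intro sum_mono mult_left_mono) (use F X Y in \<open>auto simp: bounded_sum_def\<close>)
  also have "\<dots> = (\<Sum>j\<in>fst ` F. X j) * Q"
    by (simp add: sum_distrib_right)
  also have "\<dots> \<le> P * Q"
    by (intro mult_right_mono) (use F X bounded_sum_nonneg[OF Y] in \<open>auto simp: bounded_sum_def\<close>)
  finally show "sum (\<lambda>(j, k). X j * Y j k) F \<le> P * Q" .
qed

lemma norm_infsum_le_bounded_sum:
  fixes f :: "'i \<Rightarrow> 'b::banach"
  assumes "bounded_sum M C" "\<And>i. norm (f i) \<le> M i"
  shows "f summable_on UNIV" "norm (infsum f UNIV) \<le> C"
proof -
  have M: "(\<lambda>i. norm (f i)) summable_on UNIV"
    using Infinite_Sum.abs_summable_on_comparison_test'[OF bounded_sum_summable[OF assms(1)]] assms(2) by blast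
  show s: "f summable_on UNIV" using M by (rule abs_summable_summable)
  show "norm (infsum f UNIV) \<le> C"
    using norm_infsum_le[OF has_sum_infsum[OF s] has_sum_infsum[OF bounded_sum_summable[OF assms(1)]]]
      assms(2) bounded_sum_infsum_le[OF assms(1)] by force
qed

text \<open>
  The typical contribution of one scale: it decays like a power below the critical scale, and
  the support condition, or the vanishing mean, removes it above that scale.
\<close>

definition trunc_pow :: "real \<Rightarrow> real \<Rightarrow> real" where
  "trunc_pow s y = (if y \<le> 1 then y powr s else 0)"

lemma trunc_pow_nonneg: "0 \<le> trunc_pow s y"
  by (simp add: trunc_pow_def)

definition dyadic_const :: "real \<Rightarrow> real" where
  "dyadic_const s = 1 / (1 - 2 powr (- s))"

text \<open>
  The nonzero terms run downwards from the largest \<open>j\<close> with \<open>2 powi j * t \<le> 1\<close>, so they lie below a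
  geometric series with ratio \<open>2 powr -s\<close> and first term 1, wherever \<open>t\<close> is.
\<close>

lemma bounded_sum_trunc_pow:
  assumes s: "0 < s" and t: "0 < t"
  shows "bounded_sum (\<lambda>j::int. trunc_pow s (2 powi j * t)) (dyadic_const s)"
  unfolding bounded_sum_def
proof (intro conjI allI impI)
  fix j :: int show "0 \<le> trunc_pow s (2 powi j * t)" by (rule trunc_pow_nonneg)
next
  fix F :: "int set" assume F: "finite F"
  define q :: real where "q = 2 powr (- s)"
  have q: "0 < q" "q < 1" using s by (auto simp: q_def powr_minus divide_simps)
  \<comment> \<open>the largest exponent with \<open>2 powi j0 * t \<le> 1\<close>\<close>
  define j0 where "j0 = \<lfloor>- log 2 t\<rfloor>"
  have term_le: "trunc_pow s (2 powi j * t) \<le> (if j \<le> j0 then q ^ nat (j0 - j) else 0)" for j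
  proof -
    have e: "2 powi j * t = 2 powr (j + log 2 t)"
      using t by (simp add: powr_add powr_real_of_int')
    show ?thesis
    proof (cases "j \<le> j0")
      case True
      have "(2 powi j * t) powr s = 2 powr ((j + log 2 t) * s)" by (simp add: e powr_powr)
      also have "\<dots> \<le> 2 powr ((j - j0) * s)"
      proof -
        have "real_of_int j + log 2 t \<le> real_of_int j - real_of_int j0" unfolding j0_def by linarith
        thus ?thesis using s by (intro powr_mono mult_right_mono) auto
      qed
      also have "\<dots> = q powr (real (nat (j0 - j)))"
        using True by (simp add: q_def powr_powr algebra_simps)
      also have "\<dots> = q ^ nat (j0 - j)" using q by (simp add: powr_realpow)
      finally show ?thesis using True q by (auto simp: trunc_pow_def)
    next
      case False
      hence "real_of_int j > - log 2 t" unfolding j0_def by linarith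
      hence "2 powi j * t > 1" unfolding e by simp
      thus ?thesis using False by (simp add: trunc_pow_def)
    qed
  qed
  have "(\<Sum>j\<in>F. trunc_pow s (2 powi j * t)) \<le> (\<Sum>j\<in>F. if j \<le> j0 then q ^ nat (j0 - j) else 0)"
    by (intro sum_mono term_le)
  also have "\<dots> = (\<Sum>j\<in>F \<inter> {..j0}. q ^ nat (j0 - j))"
    using F by (simp add: sum.inter_restrict)
  also have "\<dots> = (\<Sum>n\<in>(\<lambda>j. nat (j0 - j)) ` (F \<inter> {..j0}). q ^ n)"
    by (subst sum.reindex) (auto simp: inj_on_def)
  also have "\<dots> \<le> (\<Sum>n. q ^ n)"
    by (rule sum_le_suminf) (use F q in \<open>auto intro: summable_geometric\<close>)
  also have "\<dots> = dyadic_const s"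
    using q by (simp add: suminf_geometric dyadic_const_def q_def)
  finally show "(\<Sum>j\<in>F. trunc_pow s (2 powi j * t)) \<le> dyadic_const s" .
qed

section \<open>Termwise differentiation and integration\<close>

text \<open>
  This is the theorem on termwise differentiation of a sequence, carried over to another index
  type along an enumeration; the uniform convergence comes from the tails of the majorant \<open>M\<close>.
\<close>

lemma has_derivative_infsum:
  fixes f :: "'i \<Rightarrow> 'a::real_normed_vector \<Rightarrow> 'b::banach" and e :: "nat \<Rightarrow> 'i"
  assumes e: "bij e" and S: "open S" "convex S"
    and f: "\<And>i x. x \<in> S \<Longrightarrow> (f i has_derivative f' i x) (at x)"
    and M: "bounded_sum M C"
    and fM: "\<And>i x. x \<in> S \<Longrightarrow> norm (f i x) \<le> M i"
    and f'M: "\<And>i x h. x \<in> S \<Longrightarrow> norm (f' i x h) \<le> M i * norm h"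
    and x: "x \<in> S"
  shows "((\<lambda>x. \<Sum>\<^sub>\<infinity>i. f i x) has_derivative (\<lambda>h. \<Sum>\<^sub>\<infinity>i. f' i x h)) (at x)"
proof -
  have "M summable_on UNIV" using bounded_sum_summable[OF M] .
  hence "(\<lambda>n. M (e n)) summable_on UNIV"
    using summable_on_reindex_bij_betw[OF e, of M] by simp
  hence sM: "summable (\<lambda>n. M (e n))" by (rule summable_on_imp_summable)
  have sumsI: "(\<lambda>n. g (e n)) sums (\<Sum>\<^sub>\<infinity>i. g i)"
    if g: "\<And>i. norm (g i) \<le> c * M i" "c \<ge> 0" for g :: "'i \<Rightarrow> 'b" and c
  proof -
    have "g summable_on UNIV"
      using norm_infsum_le_bounded_sum(1)[OF bounded_sum_cmult[OF M g(2)] g(1)] .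
    hence "(g has_sum (\<Sum>\<^sub>\<infinity>i. g i)) UNIV" by (rule has_sum_infsum)
    hence "((\<lambda>n. g (e n)) has_sum (\<Sum>\<^sub>\<infinity>i. g i)) UNIV"
      using has_sum_reindex_bij_betw[OF e, of g] by simp
    thus ?thesis by (rule has_sum_imp_sums)
  qed
  have "\<exists>g. \<forall>x\<in>S. (\<lambda>n. f (e n) x) sums (g x) \<and>
      (g has_derivative (\<lambda>h. \<Sum>\<^sub>\<infinity>i. f' i x h)) (at x within S)"
  proof (rule has_derivative_series)
    show "convex S" by fact
    show "(f (e n) has_derivative f' (e n) y) (at y within S)" if "y \<in> S" for n y
      using f[OF that] by (rule has_derivative_at_withinI)
    show "x \<in> S" by fact
    show "(\<lambda>n. f (e n) x) sums (\<Sum>\<^sub>\<infinity>i. f i x)"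
      using sumsI[of "\<lambda>i. f i x" 1] fM[OF x] by simp
    fix \<epsilon> :: real assume \<epsilon>: "0 < \<epsilon>"
    have "(\<lambda>n. \<Sum>k. M (e (k + n))) \<longlonglongrightarrow> 0" using suminf_exist_split2[OF sM] .
    hence "\<forall>\<^sub>F n in sequentially. (\<Sum>k. M (e (k + n))) < \<epsilon>"
      using \<epsilon> by (rule order_tendstoD)
    thus "\<forall>\<^sub>F n in sequentially. \<forall>y\<in>S. \<forall>h.
        norm ((\<Sum>i<n. f' (e i) y h) - (\<Sum>\<^sub>\<infinity>i. f' i y h)) \<le> \<epsilon> * norm h"
    proof (eventually_elim, intro ballI allI)
      fix n y h assume n: "(\<Sum>k. M (e (k + n))) < \<epsilon>" and y: "y \<in> S"
      have sums: "(\<lambda>n. f' (e n) y h) sums (\<Sum>\<^sub>\<infinity>i. f' i y h)"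
        using sumsI[of "\<lambda>i. f' i y h" "norm h"] f'M[OF y] by (simp add: mult.commute)
      have sMn: "summable (\<lambda>k. M (e (k + n)) * norm h)"
        using sM by (intro summable_mult2) (simp add: summable_iff_shift[of "\<lambda>k. M (e k)"])
      have "norm ((\<Sum>i<n. f' (e i) y h) - (\<Sum>\<^sub>\<infinity>i. f' i y h)) = norm (\<Sum>k. f' (e (k + n)) y h)"
        using suminf_minus_initial_segment[OF sums_summable[OF sums], of n] sums_unique[OF sums]
        by (simp add: norm_minus_commute)
      also have "\<dots> \<le> (\<Sum>k. M (e (k + n)) * norm h)"
        by (rule norm_suminf_le[OF _ sMn]) (use f'M[OF y] in auto)
      also have "\<dots> = (\<Sum>k. M (e (k + n))) * norm h"
        using sM by (subst suminf_mult2) (simp_all add: summable_iff_shift[of "\<lambda>k. M (e k)"])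
      also have "\<dots> \<le> \<epsilon> * norm h" using n by (intro mult_right_mono) auto
      finally show "norm ((\<Sum>i<n. f' (e i) y h) - (\<Sum>\<^sub>\<infinity>i. f' i y h)) \<le> \<epsilon> * norm h" .
    qed
  qed
  then obtain g where g: "\<And>y. y \<in> S \<Longrightarrow> (\<lambda>n. f (e n) y) sums (g y)"
    and g': "\<And>y. y \<in> S \<Longrightarrow> (g has_derivative (\<lambda>h. \<Sum>\<^sub>\<infinity>i. f' i y h)) (at y within S)" by blast
  have eq: "g y = (\<Sum>\<^sub>\<infinity>i. f i y)" if "y \<in> S" for y
    using sums_unique2[OF g[OF that]] sumsI[of "\<lambda>i. f i y" 1] fM[OF that] by simp
  have "(g has_derivative (\<lambda>h. \<Sum>\<^sub>\<infinity>i. f' i x h)) (at x)"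
    using g'[OF x] at_within_open[OF x S(1)] by simp
  thus ?thesis
    by (rule has_derivative_transform_within_open[OF _ S(1) x eq])
qed

text \<open>
  Two different majorants occur.  \<open>M\<close> is pointwise and only serves to exchange sum and integral, so
  its constant \<open>C\<close> may depend on the domain \<open>A\<close>; \<open>N\<close> bounds the integrals, where cancellation has
  been used, and determines the final constant.
\<close>

lemma norm_integral_infsum_le:
  fixes f :: "'i \<Rightarrow> 'a \<Rightarrow> 'b::{banach, second_countable_topology}" and e :: "nat \<Rightarrow> 'i"
  assumes e: "bij e" and A: "A \<in> sets \<mu>" "emeasure \<mu> A < \<infinity>"
    and f: "\<And>i. set_borel_measurable \<mu> A (f i)"
    and M: "bounded_sum M C" and fM: "\<And>i x. x \<in> A \<Longrightarrow> norm (f i x) \<le> M i"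
    and N: "bounded_sum N B" and fN: "\<And>i. norm (LINT x:A|\<mu>. f i x) \<le> N i"
  shows "norm (LINT x:A|\<mu>. (\<Sum>\<^sub>\<infinity>i. f i x)) \<le> B"
proof -
  let ?F = "\<lambda>n x. indicator A x *\<^sub>R f (e n) x"
  have M0: "0 \<le> M i" for i using M by (simp add: bounded_sum_def)
  have "(\<lambda>n. M (e n)) summable_on UNIV"
    using summable_on_reindex_bij_betw[OF e, of M] bounded_sum_summable[OF M] by simp
  hence sM: "summable (\<lambda>n. M (e n))" by (rule summable_on_imp_summable)
  have iM: "integrable \<mu> (\<lambda>x. indicator A x *\<^sub>R M i)" for i
    using A by (intro integrable_scaleR_left) auto
  have FM: "norm (?F n x) \<le> indicator A x *\<^sub>R M (e n)" for n x
    using fM by (auto simp: indicator_def)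
  have iF: "integrable \<mu> (?F n)" for n
    by (rule Bochner_Integration.integrable_bound[OF iM[of "e n"]])
      (use f[of "e n"] FM M0 in \<open>auto simp: set_borel_measurable_def indicator_def\<close>)
  have sumsI: "(\<lambda>n. g (e n)) sums (\<Sum>\<^sub>\<infinity>i. g i)" if "g summable_on UNIV" for g :: "'i \<Rightarrow> 'b"
    using has_sum_reindex_bij_betw[OF e, of g] has_sum_infsum[OF that] has_sum_imp_sums by blast
  have eq: "indicator A x *\<^sub>R (\<Sum>\<^sub>\<infinity>i. f i x) = (\<Sum>n. ?F n x)" for x
  proof (cases "x \<in> A")
    case True
    thus ?thesis
      using sums_unique[OF sumsI[OF norm_infsum_le_bounded_sum(1)[OF M fM[OF True]]]] by simp
  qed simp
  have "(LINT x:A|\<mu>. (\<Sum>\<^sub>\<infinity>i. f i x)) = (\<integral>x. (\<Sum>n. ?F n x) \<partial>\<mu>)"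
    unfolding set_lebesgue_integral_def eq ..
  also have "\<dots> = (\<Sum>n. \<integral>x. ?F n x \<partial>\<mu>)"
  proof (rule integral_suminf[OF iF])
    show "AE x in \<mu>. summable (\<lambda>n. norm (?F n x))"
    proof (rule AE_I2)
      fix x show "summable (\<lambda>n. norm (?F n x))"
        by (rule summable_comparison_test'[OF sM, of 0])
          (use FM[where x = x] M0 in \<open>auto simp: indicator_def split: if_splits\<close>)
    qed
    show "summable (\<lambda>n. \<integral>x. norm (?F n x) \<partial>\<mu>)"
    proof (rule summable_comparison_test'[OF summable_mult[OF sM, of "measure \<mu> A"], of 0])
      fix n
      have "(\<integral>x. norm (?F n x) \<partial>\<mu>) \<le> (\<integral>x. indicator A x *\<^sub>R M (e n) \<partial>\<mu>)"
        by (rule integral_mono[OF integrable_norm[OF iF] iM FM])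
      also have "\<dots> = measure \<mu> A * M (e n)" using A by simp
      finally show "norm (\<integral>x. norm (?F n x) \<partial>\<mu>) \<le> measure \<mu> A * M (e n)" by simp
    qed
  qed
  also have "\<dots> = (\<Sum>\<^sub>\<infinity>i. LINT x:A|\<mu>. f i x)"
    using sums_unique[OF sumsI[OF norm_infsum_le_bounded_sum(1)[OF N fN]]]
    by (simp add: set_lebesgue_integral_def)
  also have "norm \<dots> \<le> B" by (rule norm_infsum_le_bounded_sum(2)[OF N fN])
  finally show ?thesis .
qed

section \<open>Partial derivatives and bumps\<close>

lemma partial_deriv_eq:
  assumes "(f has_derivative f') (at x)"
  shows "partial_deriv v f x = f' v"
proof -
  have "((\<lambda>t::real. x + t *\<^sub>R v) has_derivative (\<lambda>t. t *\<^sub>R v)) (at 0)"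
    by (auto intro!: derivative_eq_intros)
  moreover have "(f has_derivative f') (at (x + 0 *\<^sub>R v))" using assms by simp
  ultimately have "((\<lambda>t. f (x + t *\<^sub>R v)) has_derivative (\<lambda>t. f' (t *\<^sub>R v))) (at 0)"
    using has_derivative_compose[where g = f] by fast
  moreover have "(\<lambda>t. f' (t *\<^sub>R v)) = (\<lambda>t. t *\<^sub>R f' v)"
    using has_derivative_linear[OF assms] by (simp add: linear_scale fun_eq_iff)
  ultimately have "((\<lambda>t. f (x + t *\<^sub>R v)) has_vector_derivative f' v) (at 0)"
    by (simp add: has_vector_derivative_def)
  thus ?thesis unfolding partial_deriv_def by (rule vector_derivative_at)
qed

lemma partial_deriv_cong_open:
  assumes "open S" "x \<in> S" "\<And>y. y \<in> S \<Longrightarrow> f y = g y"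
  shows "partial_deriv v f x = partial_deriv v g x"
  unfolding partial_deriv_def
proof (rule vector_derivative_cong_eq)
  have "open ((\<lambda>t::real. x + t *\<^sub>R v) -` S)"
    by (intro open_vimage assms continuous_intros)
  moreover have "0 \<in> (\<lambda>t::real. x + t *\<^sub>R v) -` S" using assms by simp
  ultimately have "\<forall>\<^sub>F t in nhds 0. t \<in> (\<lambda>t::real. x + t *\<^sub>R v) -` S"
    by (rule eventually_nhds_in_open)
  thus "\<forall>\<^sub>F t in nhds 0. t \<in> UNIV \<longrightarrow> f (x + t *\<^sub>R v) = g (x + t *\<^sub>R v)"
    by eventually_elim (use assms in auto)
qed auto

definition bump :: "('a::euclidean_space \<Rightarrow> complex) \<Rightarrow> bool" where
  "bump f \<longleftrightarrow> smooth_on UNIV f \<and> (\<forall>x. 1 < norm x \<longrightarrow> f x = 0)"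

lemma bump_partial_deriv:
  assumes f: "bump f" and v: "v \<in> Basis"
  shows "bump (partial_deriv v f)"
  unfolding bump_def
proof (intro conjI allI impI)
  show "smooth_on UNIV (partial_deriv v f)"
    unfolding smooth_on_def
  proof (intro allI impI)
    fix vs :: "'a list" assume "set vs \<subseteq> Basis"
    hence "set (vs @ [v]) \<subseteq> Basis" using v by simp
    hence "foldr partial_deriv (vs @ [v]) f differentiable_on UNIV"
      using f unfolding bump_def smooth_on_def by blast
    thus "foldr partial_deriv vs (partial_deriv v f) differentiable_on UNIV" by simp
  qed
  fix x :: 'a assume "1 < norm x"
  hence "x \<in> - cball 0 1" by simp
  hence "partial_deriv v f x = partial_deriv v (\<lambda>_. 0) x"
    using f by (intro partial_deriv_cong_open[of "- cball 0 1"]) (auto simp: bump_def)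
  thus "partial_deriv v f x = 0" by (simp add: partial_deriv_eq[OF has_derivative_const])
qed

lemma bump_partial_deriv_funpow:
  assumes "bump f" "v \<in> Basis"
  shows "bump ((partial_deriv v ^^ n) f)"
  by (induction n) (auto simp: assms intro: bump_partial_deriv)

lemma bump_differentiable: "bump f \<Longrightarrow> f differentiable (at x)"
proof -
  assume "bump f"
  hence "foldr partial_deriv [] f differentiable_on UNIV"
    unfolding bump_def smooth_on_def by (metis empty_set empty_subsetI)
  thus ?thesis by (simp add: differentiable_on_def)
qed

lemma bump_continuous: "bump f \<Longrightarrow> continuous_on UNIV f"
  by (simp add: bump_differentiable continuous_at_imp_continuous_on differentiable_imp_continuous_within)

lemma bump_bounded:
  assumes "bump f"
  obtains B where "0 < B" "\<And>x. cmod (f x) \<le> B"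
proof -
  have "compact (f ` cball 0 1)"
    by (rule compact_continuous_image[OF continuous_on_subset[OF bump_continuous[OF assms] subset_UNIV] compact_cball])
  hence "bounded (f ` cball 0 1)" by (rule compact_imp_bounded)
  then obtain B where B: "0 < B" "\<And>x. x \<in> cball 0 1 \<Longrightarrow> cmod (f x) \<le> B"
    unfolding bounded_pos by blast
  have "cmod (f x) \<le> B" for x
    using B(1) B(2)[of x] assms by (cases "norm x \<le> 1") (auto simp: bump_def)
  thus ?thesis using B(1) that by blast
qed

lemma bump_pair_eq_0:
  fixes g :: "real \<times> real \<Rightarrow> complex"
  assumes "bump g" "1 < \<bar>u\<bar> \<or> 1 < \<bar>v\<bar>"
  shows "g (u, v) = 0"
proof -
  have "1 < norm (u, v)" using assms(2) norm_fst_le[of u v] norm_snd_le[of v u] by auto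
  thus ?thesis using assms(1) by (simp add: bump_def)
qed

text \<open>
  Writing the Frechet derivative through partial derivatives, which are bumps again, keeps termwise
  derivatives within the class of sums considered here.
\<close>

lemma bump_has_derivative_real:
  fixes f :: "real \<Rightarrow> complex"
  assumes "bump f"
  shows "(f has_derivative (\<lambda>h. h *\<^sub>R partial_deriv 1 f x)) (at x)"
proof -
  obtain f' where f': "(f has_derivative f') (at x)"
    using bump_differentiable[OF assms] unfolding differentiable_def by blast
  have "f' = (\<lambda>h. h *\<^sub>R partial_deriv 1 f x)"
  proof
    fix h
    show "f' h = h *\<^sub>R partial_deriv 1 f x"
      using linear_scale[OF has_derivative_linear[OF f'], of h 1] partial_deriv_eq[OF f', of 1] by simp
  qed
  thus ?thesis using f' by simp
qed

lemma bump_has_derivative_prod: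
  fixes f :: "real \<times> real \<Rightarrow> complex"
  assumes "bump f"
  shows "(f has_derivative (\<lambda>h. fst h *\<^sub>R partial_deriv (1, 0) f x + snd h *\<^sub>R partial_deriv (0, 1) f x)) (at x)"
proof -
  obtain f' where f': "(f has_derivative f') (at x)"
    using bump_differentiable[OF assms] unfolding differentiable_def by blast
  have "f' = (\<lambda>h. fst h *\<^sub>R partial_deriv (1, 0) f x + snd h *\<^sub>R partial_deriv (0, 1) f x)"
  proof
    fix h :: "real \<times> real"
    have "f' h = f' (fst h *\<^sub>R (1, 0) + snd h *\<^sub>R (0, 1))" by simp
    also have "\<dots> = fst h *\<^sub>R f' (1, 0) + snd h *\<^sub>R f' (0, 1)"
      by (simp only: linear_add[OF has_derivative_linear[OF f']] linear_scale[OF has_derivative_linear[OF f']])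
    finally show "f' h = fst h *\<^sub>R partial_deriv (1, 0) f x + snd h *\<^sub>R partial_deriv (0, 1) f x"
      by (simp add: partial_deriv_eq[OF f'])
  qed
  thus ?thesis using f' by simp
qed

section \<open>Multiscale sums and their derivatives\<close>

text \<open>
  The kernel is the case \<open>m = n = 2\<close>.  The weights and the two bumps are parameters in order
  to make the family stable under partial derivatives.
\<close>

definition multiscale_term ::
    "nat \<Rightarrow> nat \<Rightarrow> (real \<Rightarrow> complex) \<Rightarrow> (real \<times> real \<Rightarrow> complex) \<Rightarrow> real \<times> real \<times> real \<Rightarrow> int \<times> int \<Rightarrow> complex" where
  "multiscale_term m n f g x = (\<lambda>(j, k).
     of_real ((2 powi j) ^ m * (2 powi k) ^ n) * f (2 powi j * fst x) *
       g (2 powi k * fst (snd x), 2 powi j * 2 powi k * snd (snd x)))"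

definition multiscale_sum ::
    "nat \<Rightarrow> nat \<Rightarrow> (real \<Rightarrow> complex) \<Rightarrow> (real \<times> real \<Rightarrow> complex) \<Rightarrow> real \<times> real \<times> real \<Rightarrow> complex" where
  "multiscale_sum m n f g x = (\<Sum>\<^sub>\<infinity>i. multiscale_term m n f g x i)"

lemma dyadic_term_eq_multiscale_term: "dyadic_term f g = multiscale_term 2 2 f g"
proof (intro ext)
  fix x :: "real \<times> real \<times> real" and i :: "int \<times> int"
  obtain x1 x2 x3 where x: "x = (x1, x2, x3)" by (metis prod.exhaust)
  obtain j k where i: "i = (j, k)" by (metis prod.exhaust)
  have r: "(2::real) powi (j + k) = 2 powi j * 2 powi k" by (simp add: power_int_add)
  have "2 * j + 2 * k = (j + k) * int 2" by simp
  hence "(2::complex) powi (2 * j + 2 * k) = ((2 powi (j + k)) ^ 2)"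
    by (simp only: power_int_mult power_int_of_nat)
  also have "\<dots> = of_real ((2 powi j) ^ 2 * (2 powi k) ^ 2)"
    by (simp add: power_int_add power_mult_distrib)
  finally show "dyadic_term f g x i = multiscale_term 2 2 f g x i"
    by (simp only: x i dyadic_term_def multiscale_term_def case_prod_conv fst_conv snd_conv r)
qed

lemma dyadic_kernel_eq_multiscale_sum: "dyadic_kernel f g = multiscale_sum 2 2 f g"
  by (auto simp: fun_eq_iff dyadic_kernel_def multiscale_sum_def dyadic_term_eq_multiscale_term)

lemma multiscale_term_bound:
  assumes f: "bump f" and g: "bump g"
    and F: "\<And>x. cmod (f x) \<le> F" and G: "\<And>x. cmod (g x) \<le> G"
  shows "cmod (multiscale_term m n f g (x1, x2, x3) (j, k)) \<le>
    (if 2 powi j * \<bar>x1\<bar> \<le> 1 \<and> 2 powi k * \<bar>x2\<bar> \<le> 1 \<and> 2 powi j * 2 powi k * \<bar>x3\<bar> \<le> 1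
     then F * G * ((2 powi j) ^ m * (2 powi k) ^ n) else 0)"
proof -
  define a b :: real where "a = 2 powi j" and "b = 2 powi k"
  have ab: "0 < a" "0 < b" by (auto simp: a_def b_def)
  have f0: "f (a * x1) = 0" if "\<not> a * \<bar>x1\<bar> \<le> 1"
    using f that ab by (auto simp: bump_def abs_mult)
  have g0: "g (b * x2, a * b * x3) = 0" if "\<not> (b * \<bar>x2\<bar> \<le> 1 \<and> a * b * \<bar>x3\<bar> \<le> 1)"
    using that ab by (intro bump_pair_eq_0[OF g]) (auto simp: abs_mult)
  have "cmod (of_real (a ^ m * b ^ n)) = a ^ m * b ^ n"
    using ab by (simp only: norm_of_real) simp
  hence "cmod (multiscale_term m n f g (x1, x2, x3) (j, k)) =
      (a ^ m * b ^ n) * (cmod (f (a * x1)) * cmod (g (b * x2, a * b * x3)))"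
    by (simp only: multiscale_term_def a_def b_def norm_mult case_prod_conv fst_conv snd_conv mult.assoc)
  also have "\<dots> \<le> (a ^ m * b ^ n) * (if a * \<bar>x1\<bar> \<le> 1 \<and> b * \<bar>x2\<bar> \<le> 1 \<and> a * b * \<bar>x3\<bar> \<le> 1 then F * G else 0)"
  proof (rule mult_left_mono)
    show "cmod (f (a * x1)) * cmod (g (b * x2, a * b * x3)) \<le>
      (if a * \<bar>x1\<bar> \<le> 1 \<and> b * \<bar>x2\<bar> \<le> 1 \<and> a * b * \<bar>x3\<bar> \<le> 1 then F * G else 0)"
      using f0 g0 F G by (auto intro!: mult_mono order_trans[OF norm_ge_zero F])
  qed (use ab in auto)
  finally show ?thesis by (simp add: a_def b_def if_distrib mult.commute cong: if_cong)
qed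

text \<open>
  Away from \<open>x1 = 0\<close> and \<open>x2 = 0\<close>, where \<open>r \<le> \<bar>x1\<bar>\<close> and \<open>s \<le> \<bar>x2\<bar>\<close>, only the scales with
  \<open>2 powi j * r \<le> 1\<close> and \<open>2 powi k * s \<le> 1\<close> survive; for them the majorant is the weight itself,
  rewritten so that it is a product of truncated powers.
\<close>

definition majorant :: "nat \<Rightarrow> nat \<Rightarrow> real \<Rightarrow> real \<Rightarrow> int \<times> int \<Rightarrow> real" where
  "majorant m n r s = (\<lambda>(j, k).
     1 / (r ^ m * s ^ n) * (trunc_pow m (2 powi j * r) * trunc_pow n (2 powi k * s)))"

lemma bounded_sum_majorant:
  assumes "0 < m" "0 < n" "0 < r" "0 < s"
  shows "bounded_sum (majorant m n r s) (1 / (r ^ m * s ^ n) * (dyadic_const m * dyadic_const n))"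
proof -
  have "bounded_sum (\<lambda>(j, k). trunc_pow m (2 powi j * r) * trunc_pow n (2 powi k * s)) (dyadic_const m * dyadic_const n)"
    using assms by (intro bounded_sum_product bounded_sum_trunc_pow) auto
  from bounded_sum_cmult[OF this, of "1 / (r ^ m * s ^ n)"] assms show ?thesis
    by (simp add: majorant_def case_prod_unfold)
qed

lemma multiscale_term_le_majorant:
  assumes "bump f" "bump g" "\<And>x. cmod (f x) \<le> F" "\<And>x. cmod (g x) \<le> G"
    and m: "0 < m" "0 < n" and rs: "0 < r" "0 < s" and x: "r \<le> \<bar>fst x\<bar>" "s \<le> \<bar>fst (snd x)\<bar>"
  shows "cmod (multiscale_term m n f g x i) \<le> F * G * majorant m n r s i"
proof -
  obtain x1 x2 x3 where [simp]: "x = (x1, x2, x3)" by (metis prod.exhaust)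
  obtain j k where [simp]: "i = (j, k)" by (metis prod.exhaust)
  define a b :: real where "a = 2 powi j" and "b = 2 powi k"
  have ab: "0 < a" "0 < b" by (auto simp: a_def b_def)
  have FG: "0 \<le> F" "0 \<le> G" using assms(3,4) norm_ge_zero order_trans by blast+
  show ?thesis
  proof (cases "a * \<bar>x1\<bar> \<le> 1 \<and> b * \<bar>x2\<bar> \<le> 1 \<and> a * b * \<bar>x3\<bar> \<le> 1")
    case True
    have "a * r \<le> 1" "b * s \<le> 1"
      using True x ab order_trans[OF mult_left_mono[of r "\<bar>x1\<bar>" a]] order_trans[OF mult_left_mono[of s "\<bar>x2\<bar>" b]]
      by auto
    hence "majorant m n r s i = a ^ m * b ^ n"
      using rs ab by (simp add: majorant_def trunc_pow_def a_def[symmetric] b_def[symmetric] powr_realpow power_mult_distrib)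
    thus ?thesis
      using multiscale_term_bound[OF assms(1-4), of m n x1 x2 x3 j k] FG True ab
      by (auto simp: a_def b_def mult_ac split: if_splits)
  next
    case False
    have "0 \<le> majorant m n r s i" using rs by (simp add: majorant_def trunc_pow_nonneg)
    thus ?thesis
      using multiscale_term_bound[OF assms(1-4), of m n x1 x2 x3 j k] FG False
      by (auto simp: a_def b_def split: if_splits)
  qed
qed

lemma multiscale_term_bounded_sum:
  assumes f: "bump f" and g: "bump g" and "0 < m" "0 < n" "0 < r" "0 < s"
  obtains M C where "bounded_sum M C"
    "\<And>x i. r \<le> \<bar>fst x\<bar> \<Longrightarrow> s \<le> \<bar>fst (snd x)\<bar> \<Longrightarrow> cmod (multiscale_term m n f g x i) \<le> M i"
proof -
  obtain F where F: "0 < F" "\<And>x. cmod (f x) \<le> F" using bump_bounded[OF f] by blast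
  obtain G where G: "0 < G" "\<And>x. cmod (g x) \<le> G" using bump_bounded[OF g] by blast
  have "bounded_sum (\<lambda>i. F * G * majorant m n r s i) (F * G * (1 / (r ^ m * s ^ n) * (dyadic_const m * dyadic_const n)))"
    using assms F G by (intro bounded_sum_cmult bounded_sum_majorant) auto
  thus ?thesis
    using that multiscale_term_le_majorant[OF f g F(2) G(2)] assms by blast
qed

lemma multiscale_term_summable:
  assumes "bump f" "bump g" "0 < m" "0 < n" "fst x \<noteq> 0" "fst (snd x) \<noteq> 0"
  shows "multiscale_term m n f g x summable_on UNIV"
proof -
  obtain M C where M: "bounded_sum M C"
    "\<And>y i. \<bar>fst x\<bar> \<le> \<bar>fst y\<bar> \<Longrightarrow> \<bar>fst (snd x)\<bar> \<le> \<bar>fst (snd y)\<bar> \<Longrightarrow> cmod (multiscale_term m n f g y i) \<le> M i"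
    using multiscale_term_bounded_sum[of f g m n "\<bar>fst x\<bar>" "\<bar>fst (snd x)\<bar>"] assms by auto
  show ?thesis using norm_infsum_le_bounded_sum(1)[OF M(1) M(2)[of x]] by simp
qed

lemma multiscale_term_has_derivative:
  fixes f :: "real \<Rightarrow> complex" and g :: "real \<times> real \<Rightarrow> complex"
  assumes f: "bump f" and g: "bump g"
  shows "((\<lambda>x. multiscale_term m n f g x i) has_derivative
    (\<lambda>h. fst h *\<^sub>R multiscale_term (m + 1) n (partial_deriv 1 f) g x i +
         fst (snd h) *\<^sub>R multiscale_term m (n + 1) f (partial_deriv (1, 0) g) x i +
         snd (snd h) *\<^sub>R multiscale_term (m + 1) (n + 1) f (partial_deriv (0, 1) g) x i)) (at x)"
proof -
  obtain j k where [simp]: "i = (j, k)" by (metis prod.exhaust)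
  define a b :: real where "a = 2 powi j" and "b = 2 powi k"
  have "((\<lambda>x::real \<times> real \<times> real. a * fst x) has_derivative (\<lambda>h. a * fst h)) (at x)"
    by (auto intro!: derivative_eq_intros)
  from has_derivative_compose[OF this bump_has_derivative_real[OF f]]
  have df: "((\<lambda>x::real \<times> real \<times> real. f (a * fst x)) has_derivative
      (\<lambda>h. (a * fst h) *\<^sub>R partial_deriv 1 f (a * fst x))) (at x)" .
  have "((\<lambda>x::real \<times> real \<times> real. (b * fst (snd x), a * b * snd (snd x))) has_derivative
      (\<lambda>h. (b * fst (snd h), a * b * snd (snd h)))) (at x)"
    by (auto intro!: derivative_eq_intros)
  from has_derivative_compose[OF this bump_has_derivative_prod[OF g]]
  have dg: "((\<lambda>x::real \<times> real \<times> real. g (b * fst (snd x), a * b * snd (snd x))) has_derivative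
      (\<lambda>h. (b * fst (snd h)) *\<^sub>R partial_deriv (1, 0) g (b * fst (snd x), a * b * snd (snd x)) +
           (a * b * snd (snd h)) *\<^sub>R partial_deriv (0, 1) g (b * fst (snd x), a * b * snd (snd x)))) (at x)" 
    by simp
  have "((\<lambda>x. of_real (a ^ m * b ^ n) * f (a * fst x) * g (b * fst (snd x), a * b * snd (snd x))) has_derivative
    (\<lambda>h. fst h *\<^sub>R (of_real (a ^ (m + 1) * b ^ n) * partial_deriv 1 f (a * fst x) * g (b * fst (snd x), a * b * snd (snd x))) +
         fst (snd h) *\<^sub>R (of_real (a ^ m * b ^ (n + 1)) * f (a * fst x) * partial_deriv (1, 0) g (b * fst (snd x), a * b * snd (snd x))) +
         snd (snd h) *\<^sub>R (of_real (a ^ (m + 1) * b ^ (n + 1)) * f (a * fst x) * partial_deriv (0, 1) g (b * fst (snd x), a * b * snd (snd x))))) (at x)"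
    by (rule has_derivative_eq_rhs[OF has_derivative_mult[OF has_derivative_mult[OF has_derivative_const df] dg]])
      (simp add: fun_eq_iff scaleR_conv_of_real algebra_simps)
  thus ?thesis by (simp add: multiscale_term_def a_def b_def)
qed

lemma ex_bij_nat_int_prod: "\<exists>e :: nat \<Rightarrow> int \<times> int. bij e"
  by (rule exI[of _ "from_nat_into UNIV"], rule bij_betw_from_nat_into) (auto simp: finite_prod)

text \<open>
  Halving the distances of \<open>x\<close> to the planes \<open>x1 = 0\<close> and \<open>x2 = 0\<close> gives a convex neighbourhood
  on which the terms and their derivatives have one common summable majorant.
\<close>

lemma multiscale_sum_has_derivative:
  fixes f :: "real \<Rightarrow> complex" and g :: "real \<times> real \<Rightarrow> complex"
  assumes f: "bump f" and g: "bump g" and m: "0 < m" "0 < n"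
    and x: "fst x \<noteq> 0" "fst (snd x) \<noteq> 0"
  shows "(multiscale_sum m n f g has_derivative
    (\<lambda>h. fst h *\<^sub>R multiscale_sum (m + 1) n (partial_deriv 1 f) g x +
         fst (snd h) *\<^sub>R multiscale_sum m (n + 1) f (partial_deriv (1, 0) g) x +
         snd (snd h) *\<^sub>R multiscale_sum (m + 1) (n + 1) f (partial_deriv (0, 1) g) x)) (at x)"
proof -
  define r s where "r = \<bar>fst x\<bar> / 2" and "s = \<bar>fst (snd x)\<bar> / 2"
  have rs: "0 < r" "0 < s" using x by (auto simp: r_def s_def)
  \<comment> \<open>the support conditions in \<open>x1\<close> and \<open>x2\<close> already confine the scales, so \<open>x3\<close> ranges freely\<close>
  define S where "S = ball (fst x) r \<times> ball (fst (snd x)) s \<times> (UNIV :: real set)"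
  have S: "open S" "convex S" "x \<in> S"
    using rs by (auto simp: S_def mem_Times_iff intro!: open_Times convex_Times)
  have far: "r \<le> \<bar>fst y\<bar>" "s \<le> \<bar>fst (snd y)\<bar>" if "y \<in> S" for y
  proof -
    have "\<bar>fst x - fst y\<bar> < r" "\<bar>fst (snd x) - fst (snd y)\<bar> < s"
      using that by (auto simp: S_def dist_real_def mem_Times_iff)
    thus "r \<le> \<bar>fst y\<bar>" "s \<le> \<bar>fst (snd y)\<bar>" unfolding r_def s_def by linarith+
  qed
  have f1: "bump (partial_deriv 1 f)" and g1: "bump (partial_deriv (1, 0) g)" and g2: "bump (partial_deriv (0, 1) g)"
    using f g by (auto intro!: bump_partial_deriv simp: Basis_prod_def)
  obtain M0 C0 where M0: "bounded_sum M0 C0"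
    "\<And>x i. r \<le> \<bar>fst x\<bar> \<Longrightarrow> s \<le> \<bar>fst (snd x)\<bar> \<Longrightarrow> cmod (multiscale_term m n f g x i) \<le> M0 i"
    using multiscale_term_bounded_sum[OF f g m rs] by metis
  obtain M1 C1 where M1: "bounded_sum M1 C1"
    "\<And>x i. r \<le> \<bar>fst x\<bar> \<Longrightarrow> s \<le> \<bar>fst (snd x)\<bar> \<Longrightarrow> cmod (multiscale_term (m + 1) n (partial_deriv 1 f) g x i) \<le> M1 i"
    using multiscale_term_bounded_sum[OF f1 g _ m(2) rs, of "m + 1"] by auto
  obtain M2 C2 where M2: "bounded_sum M2 C2"
    "\<And>x i. r \<le> \<bar>fst x\<bar> \<Longrightarrow> s \<le> \<bar>fst (snd x)\<bar> \<Longrightarrow> cmod (multiscale_term m (n + 1) f (partial_deriv (1, 0) g) x i) \<le> M2 i"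
    using multiscale_term_bounded_sum[OF f g1 m(1) _ rs, of "n + 1"] by auto
  obtain M3 C3 where M3: "bounded_sum M3 C3"
    "\<And>x i. r \<le> \<bar>fst x\<bar> \<Longrightarrow> s \<le> \<bar>fst (snd x)\<bar> \<Longrightarrow> cmod (multiscale_term (m + 1) (n + 1) f (partial_deriv (0, 1) g) x i) \<le> M3 i"
    using multiscale_term_bounded_sum[OF f g2 _ _ rs, of "m + 1" "n + 1"] by auto
  let ?T1 = "multiscale_term (m + 1) n (partial_deriv 1 f) g"
  let ?T2 = "multiscale_term m (n + 1) f (partial_deriv (1, 0) g)"
  let ?T3 = "multiscale_term (m + 1) (n + 1) f (partial_deriv (0, 1) g)"
  define M where "M i = M0 i + (M1 i + (M2 i + M3 i))" for i
  have M: "bounded_sum M (C0 + (C1 + (C2 + C3)))"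
    unfolding M_def by (intro bounded_sum_add M0 M1 M2 M3)
  have nn: "0 \<le> M0 i" "0 \<le> M1 i" "0 \<le> M2 i" "0 \<le> M3 i" for i
    by (intro bounded_sum_ge_0[OF M0(1)] bounded_sum_ge_0[OF M1(1)] bounded_sum_ge_0[OF M2(1)] bounded_sum_ge_0[OF M3(1)])+
  obtain e :: "nat \<Rightarrow> int \<times> int" where e: "bij e" using ex_bij_nat_int_prod by blast
  have "((\<lambda>y. \<Sum>\<^sub>\<infinity>i. multiscale_term m n f g y i) has_derivative
      (\<lambda>h. \<Sum>\<^sub>\<infinity>i. fst h *\<^sub>R ?T1 x i + fst (snd h) *\<^sub>R ?T2 x i + snd (snd h) *\<^sub>R ?T3 x i)) (at x)"
  proof (rule has_derivative_infsum[OF e S(1,2) _ M _ _ S(3)])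
    fix i y
    show "((\<lambda>y. multiscale_term m n f g y i) has_derivative
        (\<lambda>h. fst h *\<^sub>R ?T1 y i + fst (snd h) *\<^sub>R ?T2 y i + snd (snd h) *\<^sub>R ?T3 y i)) (at y)"
      by (rule multiscale_term_has_derivative[OF f g])
    assume y: "y \<in> S"
    show "cmod (multiscale_term m n f g y i) \<le> M i"
      using M0(2)[OF far[OF y], of i] nn[of i] by (simp add: M_def)
    fix h :: "real \<times> real \<times> real"
    have h: "\<bar>fst h\<bar> \<le> norm h" "\<bar>fst (snd h)\<bar> \<le> norm h" "\<bar>snd (snd h)\<bar> \<le> norm h"
      using norm_fst_le[of "fst h" "snd h"] norm_snd_le[of "snd h" "fst h"]
        norm_fst_le[of "fst (snd h)" "snd (snd h)"] norm_snd_le[of "snd (snd h)" "fst (snd h)"] by auto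
    have "cmod (fst h *\<^sub>R ?T1 y i + fst (snd h) *\<^sub>R ?T2 y i + snd (snd h) *\<^sub>R ?T3 y i)
        \<le> \<bar>fst h\<bar> * cmod (?T1 y i) + \<bar>fst (snd h)\<bar> * cmod (?T2 y i) + \<bar>snd (snd h)\<bar> * cmod (?T3 y i)"
      by (intro order_trans[OF norm_triangle_ineq] add_mono) auto
    also have "\<dots> \<le> norm h * M1 i + norm h * M2 i + norm h * M3 i"
      using h far[OF y] by (intro add_mono mult_mono M1(2) M2(2) M3(2)) auto
    also have "\<dots> \<le> M i * norm h" using nn[of i] by (simp add: M_def algebra_simps)
    finally show "cmod (fst h *\<^sub>R ?T1 y i + fst (snd h) *\<^sub>R ?T2 y i + snd (snd h) *\<^sub>R ?T3 y i) \<le> M i * norm h" .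
  qed
  moreover have "(\<Sum>\<^sub>\<infinity>i. fst h *\<^sub>R ?T1 x i + fst (snd h) *\<^sub>R ?T2 x i + snd (snd h) *\<^sub>R ?T3 x i) =
     fst h *\<^sub>R multiscale_sum (m + 1) n (partial_deriv 1 f) g x +
         fst (snd h) *\<^sub>R multiscale_sum m (n + 1) f (partial_deriv (1, 0) g) x +
         snd (snd h) *\<^sub>R multiscale_sum (m + 1) (n + 1) f (partial_deriv (0, 1) g) x" for h :: "real \<times> real \<times> real"
  proof -
    have "?T1 x summable_on UNIV" "?T2 x summable_on UNIV" "?T3 x summable_on UNIV"
      using multiscale_term_summable[OF f1 g, of "m + 1" n x] multiscale_term_summable[OF f g1, of m "n + 1" x]
        multiscale_term_summable[OF f g2, of "m + 1" "n + 1" x] m x by simp_all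
    hence "((\<lambda>i. fst h *\<^sub>R ?T1 x i + fst (snd h) *\<^sub>R ?T2 x i + snd (snd h) *\<^sub>R ?T3 x i) has_sum
       (fst h *\<^sub>R multiscale_sum (m + 1) n (partial_deriv 1 f) g x +
         fst (snd h) *\<^sub>R multiscale_sum m (n + 1) f (partial_deriv (1, 0) g) x +
         snd (snd h) *\<^sub>R multiscale_sum (m + 1) (n + 1) f (partial_deriv (0, 1) g) x)) UNIV"
      unfolding multiscale_sum_def by (intro has_sum_add has_sum_scaleR has_sum_infsum)
    thus ?thesis by (rule infsumI)
  qed
  ultimately show ?thesis by (simp add: multiscale_sum_def[abs_def])
qed

lemma multiscale_sum_partial_derivs:
  assumes f: "bump f" and g: "bump g" and m: "0 < m" "0 < n"
    and x: "fst x \<noteq> 0" "fst (snd x) \<noteq> 0"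
  shows "partial_deriv (1, 0, 0) (multiscale_sum m n f g) x = multiscale_sum (m + 1) n (partial_deriv 1 f) g x"
    and "partial_deriv (0, 1, 0) (multiscale_sum m n f g) x = multiscale_sum m (n + 1) f (partial_deriv (1, 0) g) x"
    and "partial_deriv (0, 0, 1) (multiscale_sum m n f g) x = multiscale_sum (m + 1) (n + 1) f (partial_deriv (0, 1) g) x"
  by (simp_all add: partial_deriv_eq[OF multiscale_sum_has_derivative[OF assms]])

definition off_planes :: "(real \<times> real \<times> real) set" where
  "off_planes = {(x1, x2, x3). x1 * x2 * x3 \<noteq> 0}"

lemma off_planesD: "x \<in> off_planes \<Longrightarrow> fst x \<noteq> 0 \<and> fst (snd x) \<noteq> 0"
  by (auto simp: off_planes_def)

lemma open_off_planes: "open off_planes"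
proof -
  have "off_planes = (\<lambda>x. fst x * fst (snd x) * snd (snd x)) -` (- {0})"
    by (auto simp: off_planes_def)
  moreover have "open ((\<lambda>x::real \<times> real \<times> real. fst x * fst (snd x) * snd (snd x)) -` (- {0}))"
    by (intro open_vimage continuous_intros)
  ultimately show ?thesis by simp
qed

text \<open>
  The weights only grow, so they stay positive, which is what convergence needs.
\<close>

lemma multiscale_sum_foldr_partial_deriv:
  assumes "bump f" "bump g" "0 < m" "0 < n" "set vs \<subseteq> Basis"
  shows "\<exists>m' n' f' g'. bump f' \<and> bump g' \<and> 0 < m' \<and> 0 < n' \<and>
    (\<forall>x\<in>off_planes. foldr partial_deriv vs (multiscale_sum m n f g) x = multiscale_sum m' n' f' g' x)"
  using assms(5)
proof (induction vs)
  case Nil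
  show ?case using assms by auto
next
  case (Cons v vs)
  then obtain m' n' f' g' where IH: "bump f'" "bump g'" "0 < m'" "0 < n'"
    "\<And>x. x \<in> off_planes \<Longrightarrow> foldr partial_deriv vs (multiscale_sum m n f g) x = multiscale_sum m' n' f' g' x"
    by auto
  have eq: "foldr partial_deriv (v # vs) (multiscale_sum m n f g) x = partial_deriv v (multiscale_sum m' n' f' g') x"
    if "x \<in> off_planes" for x
    using partial_deriv_cong_open[OF open_off_planes that IH(5)] by simp
  note pd = multiscale_sum_partial_derivs[OF IH(1-4) off_planesD[THEN conjunct1] off_planesD[THEN conjunct2]]
  have "v = (1, 0, 0) \<or> v = (0, 1, 0) \<or> v = (0, 0, 1)"
    using Cons.prems by (auto simp: Basis_prod_def zero_prod_def)
  thus ?case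
  proof (elim disjE)
    assume "v = (1, 0, 0)"
    thus ?thesis using eq pd(1) IH
      by (intro exI[of _ "m' + 1"] exI[of _ n'] exI[of _ "partial_deriv 1 f'"] exI[of _ g'])
         (auto intro: bump_partial_deriv)
  next
    assume "v = (0, 1, 0)"
    thus ?thesis using eq pd(2) IH
      by (intro exI[of _ m'] exI[of _ "n' + 1"] exI[of _ f'] exI[of _ "partial_deriv (1, 0) g'"])
         (auto intro!: bump_partial_deriv simp: Basis_prod_def)
  next
    assume "v = (0, 0, 1)"
    thus ?thesis using eq pd(3) IH
      by (intro exI[of _ "m' + 1"] exI[of _ "n' + 1"] exI[of _ f'] exI[of _ "partial_deriv (0, 1) g'"])
         (auto intro!: bump_partial_deriv simp: Basis_prod_def)
  qed
qed

lemma smooth_on_multiscale_sum: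
  assumes "bump f" "bump g" "0 < m" "0 < n"
  shows "smooth_on off_planes (multiscale_sum m n f g)"
  unfolding smooth_on_def
proof (intro allI impI)
  fix vs :: "(real \<times> real \<times> real) list" assume "set vs \<subseteq> Basis"
  then obtain m' n' f' g' where h: "bump f'" "bump g'" "0 < m'" "0 < n'"
    "\<And>x. x \<in> off_planes \<Longrightarrow> foldr partial_deriv vs (multiscale_sum m n f g) x = multiscale_sum m' n' f' g' x"
    using multiscale_sum_foldr_partial_deriv[OF assms] by metis
  show "foldr partial_deriv vs (multiscale_sum m n f g) differentiable_on off_planes"
    unfolding differentiable_on_def
  proof
    fix x assume x: "x \<in> off_planes"
    obtain D where "(multiscale_sum m' n' f' g' has_derivative D) (at x)"
      using multiscale_sum_has_derivative[OF h(1-4)] off_planesD[OF x] by blast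
    hence "(foldr partial_deriv vs (multiscale_sum m n f g) has_derivative D) (at x)"
      by (rule has_derivative_transform_within_open[OF _ open_off_planes x]) (simp add: h(5))
    thus "foldr partial_deriv vs (multiscale_sum m n f g) differentiable (at x within off_planes)"
      by (blast intro: differentiableI has_derivative_at_withinI)
  qed
qed

text \<open>
  The identities for derivatives hold off the coordinate planes only.  They can still be iterated,
  because a partial derivative depends on nearby values only and the domain is open.
\<close>

lemma partial_deriv_funpow_cong:
  assumes base: "\<And>x. x \<in> off_planes \<Longrightarrow> h x = F 0 x"
    and step: "\<And>l x. x \<in> off_planes \<Longrightarrow> partial_deriv v (F l) x = F (Suc l) x"
  shows "x \<in> off_planes \<Longrightarrow> (partial_deriv v ^^ l) h x = F l x"
proof (induction l arbitrary: x)
  case (Suc l)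
  have "partial_deriv v ((partial_deriv v ^^ l) h) x = partial_deriv v (F l) x"
    by (rule partial_deriv_cong_open[OF open_off_planes Suc.prems Suc.IH])
  thus ?case using step[OF Suc.prems] by simp
qed (use base in simp)

lemma partial3_multiscale_sum:
  fixes f :: "real \<Rightarrow> complex" and g :: "real \<times> real \<Rightarrow> complex"
  assumes f: "bump f" and g: "bump g" and m: "0 < m" "0 < n" and x: "x \<in> off_planes"
  shows "partial3 \<alpha> \<beta> \<gamma> (multiscale_sum m n f g) x =
    multiscale_sum (m + \<gamma> + \<alpha>) (n + \<gamma> + \<beta>) ((partial_deriv 1 ^^ \<alpha>) f)
      ((partial_deriv (1, 0) ^^ \<beta>) ((partial_deriv (0, 1) ^^ \<gamma>) g)) x"
proof -
  let ?g = "\<lambda>c. (partial_deriv (0, 1) ^^ c) g"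
  let ?h = "\<lambda>b. (partial_deriv (1, 0) ^^ b) (?g \<gamma>)"
  let ?f = "\<lambda>a. (partial_deriv 1 ^^ a) f"
  have bf: "bump (?f a)" for a using bump_partial_deriv_funpow[OF f] by auto
  have bg: "bump (?g c)" for c using bump_partial_deriv_funpow[OF g] by (auto simp: Basis_prod_def)
  have bh: "bump (?h b)" for b using bump_partial_deriv_funpow[OF bg] by (auto simp: Basis_prod_def)
  have 3: "(partial_deriv (0, 0, 1) ^^ \<gamma>) (multiscale_sum m n f g) y = multiscale_sum (m + \<gamma>) (n + \<gamma>) f (?g \<gamma>) y"
    if "y \<in> off_planes" for y
    using that
  proof (rule partial_deriv_funpow_cong[where F = "\<lambda>c. multiscale_sum (m + c) (n + c) f (?g c)", rotated 2])
    fix l z assume "z \<in> off_planes"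
    thus "partial_deriv (0, 0, 1) (multiscale_sum (m + l) (n + l) f (?g l)) z =
        multiscale_sum (m + Suc l) (n + Suc l) f (?g (Suc l)) z"
      using multiscale_sum_partial_derivs(3)[OF f bg, of "m + l" "n + l" z l] m off_planesD[of z] by simp
  qed simp
  have 2: "(partial_deriv (0, 1, 0) ^^ \<beta>) ((partial_deriv (0, 0, 1) ^^ \<gamma>) (multiscale_sum m n f g)) y =
      multiscale_sum (m + \<gamma>) (n + \<gamma> + \<beta>) f (?h \<beta>) y"
    if "y \<in> off_planes" for y
    using that
  proof (rule partial_deriv_funpow_cong[where F = "\<lambda>b. multiscale_sum (m + \<gamma>) (n + \<gamma> + b) f (?h b)", rotated 2])
    fix l z assume "z \<in> off_planes"
    thus "partial_deriv (0, 1, 0) (multiscale_sum (m + \<gamma>) (n + \<gamma> + l) f (?h l)) z =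
        multiscale_sum (m + \<gamma>) (n + \<gamma> + Suc l) f (?h (Suc l)) z"
      using multiscale_sum_partial_derivs(2)[OF f bh, of "m + \<gamma>" "n + \<gamma> + l" z l] m off_planesD[of z] by simp
  qed (use 3 in simp)
  show ?thesis
    unfolding partial3_def using x
  proof (rule partial_deriv_funpow_cong[where F = "\<lambda>a. multiscale_sum (m + \<gamma> + a) (n + \<gamma> + \<beta>) (?f a) (?h \<beta>)", rotated 2])
    fix l z assume "z \<in> off_planes"
    thus "partial_deriv (1, 0, 0) (multiscale_sum (m + \<gamma> + l) (n + \<gamma> + \<beta>) (?f l) (?h \<beta>)) z =
        multiscale_sum (m + \<gamma> + Suc l) (n + \<gamma> + \<beta>) (?f (Suc l)) (?h \<beta>) z"
      using multiscale_sum_partial_derivs(1)[OF bf bh, of "m + \<gamma> + l" "n + \<gamma> + \<beta>" z l \<beta>] m off_planesD[of z] by simp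
  qed (use 2 in simp)
qed

section \<open>The pointwise estimate\<close>

lemma powr_le_balanced_ratio:
  fixes R \<theta> :: real
  assumes R: "0 < R" and \<theta>: "0 < \<theta>" "\<theta> < 1"
  shows "R \<le> 1 \<Longrightarrow> R powr \<theta> \<le> 2 * (R + 1 / R) powr (- \<theta>)"
    and "1 \<le> R \<Longrightarrow> R powr (- \<theta>) \<le> 2 * (R + 1 / R) powr (- \<theta>)"
proof -
  have large: "T powr (- \<theta>) \<le> 2 * (T + 1 / T) powr (- \<theta>)" if T: "1 \<le> T" for T :: real
  proof -
    have "2 powr (- \<theta>) * T powr (- \<theta>) = (2 * T) powr (- \<theta>)" using T by (simp add: powr_mult)
    also have "\<dots> \<le> (T + 1 / T) powr (- \<theta>)"
    proof (rule powr_mono2')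
      have "1 / T \<le> 1" using T by simp
      thus "T + 1 / T \<le> 2 * T" using T by linarith
    qed (use T \<theta> in \<open>auto intro: add_pos_pos\<close>)
    finally have *: "2 powr (- \<theta>) * T powr (- \<theta>) \<le> (T + 1 / T) powr (- \<theta>)" .
    have "T powr (- \<theta>) = 2 powr \<theta> * (2 powr (- \<theta>) * T powr (- \<theta>))" by (simp add: powr_minus)
    also have "\<dots> \<le> 2 powr 1 * (T + 1 / T) powr (- \<theta>)"
      using * \<theta> by (intro mult_mono powr_mono) auto
    finally show ?thesis by simp
  qed
  show "1 \<le> R \<Longrightarrow> R powr (- \<theta>) \<le> 2 * (R + 1 / R) powr (- \<theta>)" by (rule large)
  show "R powr \<theta> \<le> 2 * (R + 1 / R) powr (- \<theta>)" if "R \<le> 1"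
    using large[of "1 / R"] R that by (simp add: powr_divide powr_minus_divide add.commute)
qed

text \<open>
  For \<open>R \<ge> 1\<close> the factor \<open>R powr -\<theta>\<close> is gained from the third support condition: with \<open>p = u * v\<close>, the
  product \<open>p = p powr (1 - \<theta>) * (p * R) powr \<theta> * R powr -\<theta>\<close> has its middle factor at most 1.  For \<open>R < 1\<close>
  the third condition is implied by the first two, and the explicit factor \<open>R\<close> is the gain.
\<close>

lemma product_le_balanced_ratio:
  fixes u v R \<theta> :: real
  assumes u: "0 < u" "u \<le> 1" and v: "0 < v" "v \<le> 1" and R: "0 < R" "u * v * R \<le> 1"
    and \<theta>: "0 < \<theta>" "\<theta> < 1"
  shows "u * v * (u * v * R) \<le> 2 * (R + 1 / R) powr (- \<theta>) * (u powr (1 - \<theta>) * v powr (1 - \<theta>))"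
proof -
  define p where "p = u * v"
  have p: "0 < p" "p \<le> 1" using u v by (auto simp: p_def mult_le_one)
  have pp: "u powr (1 - \<theta>) * v powr (1 - \<theta>) = p powr (1 - \<theta>)" by (simp add: p_def powr_mult u v)
  have p0: "0 \<le> p powr (1 - \<theta>)" by simp
  have "p * (p * R) \<le> 2 * (R + 1 / R) powr (- \<theta>) * p powr (1 - \<theta>)"
  proof (cases "1 \<le> R")
    case True
    have "p * (p * R) \<le> p * 1" using p R(2) by (intro mult_left_mono) (auto simp: p_def)
    also have "p * 1 = p powr (1 - \<theta>) * (p * R) powr \<theta> * R powr (- \<theta>)"
    proof -
      have "(p * R) powr \<theta> * R powr (- \<theta>) = p powr \<theta>"
        using p R(1) by (simp add: powr_mult powr_minus)
      moreover have "p powr (1 - \<theta>) * p powr \<theta> = p" using p by (simp flip: powr_add)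
      ultimately show ?thesis by (simp add: mult.assoc)
    qed
    also have "\<dots> \<le> p powr (1 - \<theta>) * 1 * R powr (- \<theta>)"
      using p R \<theta> by (intro mult_left_mono mult_right_mono powr_le1) (auto simp: p_def)
    also have "\<dots> \<le> p powr (1 - \<theta>) * (2 * (R + 1 / R) powr (- \<theta>))"
      using powr_le_balanced_ratio(2)[OF R(1) \<theta> True] by (simp add: mult_left_mono)
    finally show ?thesis by (simp add: mult_ac)
  next
    case False
    have "p * (p * R) \<le> p * (1 * R)" using p R by (intro mult_left_mono mult_right_mono) auto
    also have "\<dots> = p powr 1 * R powr 1" using p R by simp
    also have "\<dots> \<le> p powr (1 - \<theta>) * R powr \<theta>"
      using p R False \<theta> by (intro mult_mono powr_mono') auto
    also have "\<dots> \<le> p powr (1 - \<theta>) * (2 * (R + 1 / R) powr (- \<theta>))"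
      using powr_le_balanced_ratio(1)[OF R(1) \<theta>] False by (simp add: mult_left_mono)
    finally show ?thesis by (simp add: mult_ac)
  qed
  thus ?thesis by (simp add: pp p_def[symmetric])
qed

text \<open>
  In the scale-invariant quantities \<open>u = a * X\<close>, \<open>v = b * Y\<close>, \<open>w = a * b * Z\<close> the weight is
  \<open>u ^ (\<alpha> + 1) * v ^ (\<beta> + 1) * w ^ (\<gamma> + 1)\<close> up to the expected power of \<open>X\<close>, \<open>Y\<close>, \<open>Z\<close>, hence at most
  \<open>u * v * w\<close>.
\<close>

lemma dyadic_weight_le:
  fixes a b X Y Z \<theta> :: real
  assumes ab: "0 < a" "0 < b" and XYZ: "0 < X" "0 < Y" "0 < Z"
    and le: "a * X \<le> 1" "b * Y \<le> 1" "a * b * Z \<le> 1" and \<theta>: "0 < \<theta>" "\<theta> < 1"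
  shows "a ^ (2 + \<gamma> + \<alpha>) * b ^ (2 + \<gamma> + \<beta>) \<le>
    2 / (X ^ (\<alpha> + 1) * Y ^ (\<beta> + 1) * Z ^ (\<gamma> + 1)) * (X * Y / Z + Z / (X * Y)) powr (- \<theta>) *
      (trunc_pow (1 - \<theta>) (a * X) * trunc_pow (1 - \<theta>) (b * Y))"
proof -
  define u v R where "u = a * X" and "v = b * Y" and "R = Z / (X * Y)"
  have u: "0 < u" "u \<le> 1" and v: "0 < v" "v \<le> 1" and R: "0 < R"
    using assms by (auto simp: u_def v_def R_def)
  have w: "u * v * R = a * b * Z" using XYZ by (simp add: u_def v_def R_def)
  have R': "X * Y / Z = 1 / R" using XYZ by (simp add: R_def)
  define D where "D = X ^ (\<alpha> + 1) * Y ^ (\<beta> + 1) * Z ^ (\<gamma> + 1)"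
  have D: "0 < D" using XYZ by (simp add: D_def)
  have "a ^ (2 + \<gamma> + \<alpha>) * b ^ (2 + \<gamma> + \<beta>) * D = u ^ (\<alpha> + 1) * v ^ (\<beta> + 1) * (u * v * R) ^ (\<gamma> + 1)"
    unfolding w by (simp add: u_def v_def D_def power_mult_distrib power_add power2_eq_square mult_ac)
  also have "\<dots> \<le> u ^ 1 * v ^ 1 * (u * v * R) ^ 1"
  proof -
    have "0 \<le> u * v * R" using u v R by simp
    thus ?thesis using u v R le w by (intro mult_mono power_decreasing) auto
  qed
  also have "\<dots> \<le> 2 * (R + 1 / R) powr (- \<theta>) * (u powr (1 - \<theta>) * v powr (1 - \<theta>))"
    using product_le_balanced_ratio[OF u v R _ \<theta>] le w by simp
  finally have "a ^ (2 + \<gamma> + \<alpha>) * b ^ (2 + \<gamma> + \<beta>) \<le>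
      2 * (R + 1 / R) powr (- \<theta>) * (u powr (1 - \<theta>) * v powr (1 - \<theta>)) / D"
    using D by (simp add: pos_le_divide_eq)
  thus ?thesis
    using u v unfolding D_def[symmetric] R' R_def[symmetric] trunc_pow_def u_def[symmetric] v_def[symmetric]
    by (simp add: mult_ac add.commute)
qed

lemma multiscale_sum_pointwise_bound:
  assumes f: "bump f" and g: "bump g" and \<theta>: "0 < \<theta>" "\<theta> < 1"
  shows "\<exists>C. \<forall>x1 x2 x3. x1 * x2 * x3 \<noteq> 0 \<longrightarrow>
    cmod (multiscale_sum (2 + \<gamma> + \<alpha>) (2 + \<gamma> + \<beta>) f g (x1, x2, x3)) \<le>
      C / (\<bar>x1\<bar> ^ (\<alpha> + 1) * \<bar>x2\<bar> ^ (\<beta> + 1) * \<bar>x3\<bar> ^ (\<gamma> + 1)) *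
        (\<bar>x1 * x2 / x3\<bar> + \<bar>x3 / (x1 * x2)\<bar>) powr (- \<theta>)"
proof -
  obtain F where F: "0 < F" "\<And>x. cmod (f x) \<le> F" using bump_bounded[OF f] by blast
  obtain G where G: "0 < G" "\<And>x. cmod (g x) \<le> G" using bump_bounded[OF g] by blast
  define c where "c = dyadic_const (1 - \<theta>)"
  show ?thesis
  proof (intro exI[of _ "F * G * 2 * (c * c)"] allI impI)
    fix x1 x2 x3 :: real assume x: "x1 * x2 * x3 \<noteq> 0"
    define E where "E = 2 / (\<bar>x1\<bar> ^ (\<alpha> + 1) * \<bar>x2\<bar> ^ (\<beta> + 1) * \<bar>x3\<bar> ^ (\<gamma> + 1)) *
        (\<bar>x1\<bar> * \<bar>x2\<bar> / \<bar>x3\<bar> + \<bar>x3\<bar> / (\<bar>x1\<bar> * \<bar>x2\<bar>)) powr (- \<theta>)"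
    have E: "0 \<le> E" by (simp add: E_def)
    \<comment> \<open>\<open>E\<close> is the bound to be proved, up to a constant; what is left of each term is summable\<close>
    define M where "M = (\<lambda>i. F * G * E * (case i of (j, k) \<Rightarrow>
        trunc_pow (1 - \<theta>) (2 powi j * \<bar>x1\<bar>) * trunc_pow (1 - \<theta>) (2 powi k * \<bar>x2\<bar>)))"
    have "bounded_sum (\<lambda>(j, k). trunc_pow (1 - \<theta>) (2 powi j * \<bar>x1\<bar>) * trunc_pow (1 - \<theta>) (2 powi k * \<bar>x2\<bar>)) (c * c)"
      unfolding c_def using x \<theta> by (intro bounded_sum_product bounded_sum_trunc_pow) auto
    hence M: "bounded_sum M (F * G * E * (c * c))"
      unfolding M_def using F(1) G(1) E by (intro bounded_sum_cmult) auto
    have "cmod (multiscale_term (2 + \<gamma> + \<alpha>) (2 + \<gamma> + \<beta>) f g (x1, x2, x3) i) \<le> M i" for i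
    proof -
      obtain j k where i: "i = (j, k)" by (metis prod.exhaust)
      define a b :: real where "a = 2 powi j" and "b = 2 powi k"
      have ab: "0 < a" "0 < b" by (auto simp: a_def b_def)
      have M0: "0 \<le> M i" by (rule bounded_sum_ge_0[OF M])
      note T = multiscale_term_bound[OF f g F(2) G(2), of "2 + \<gamma> + \<alpha>" "2 + \<gamma> + \<beta>" x1 x2 x3 j k,
          folded a_def b_def]
      show ?thesis
      proof (cases "a * \<bar>x1\<bar> \<le> 1 \<and> b * \<bar>x2\<bar> \<le> 1 \<and> a * b * \<bar>x3\<bar> \<le> 1")
        case True
        have "a ^ (2 + \<gamma> + \<alpha>) * b ^ (2 + \<gamma> + \<beta>) \<le>
           E * (trunc_pow (1 - \<theta>) (a * \<bar>x1\<bar>) * trunc_pow (1 - \<theta>) (b * \<bar>x2\<bar>))"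
          unfolding E_def by (rule dyadic_weight_le[OF ab]) (use True x \<theta> in auto)
        hence "F * G * (a ^ (2 + \<gamma> + \<alpha>) * b ^ (2 + \<gamma> + \<beta>)) \<le> M i"
          unfolding M_def i a_def[symmetric] b_def[symmetric] prod.case mult.assoc
          using F(1) G(1) by (intro mult_left_mono) auto
        thus ?thesis using T True i by simp
      next
        case False
        hence "cmod (multiscale_term (2 + \<gamma> + \<alpha>) (2 + \<gamma> + \<beta>) f g (x1, x2, x3) i) \<le> 0"
          using T i by (simp only: if_False)
        thus ?thesis using M0 by linarith
      qed
    qed
    hence "cmod (multiscale_sum (2 + \<gamma> + \<alpha>) (2 + \<gamma> + \<beta>) f g (x1, x2, x3)) \<le> F * G * E * (c * c)"
      unfolding multiscale_sum_def by (rule norm_infsum_le_bounded_sum(2)[OF M])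
    thus "cmod (multiscale_sum (2 + \<gamma> + \<alpha>) (2 + \<gamma> + \<beta>) f g (x1, x2, x3)) \<le>
        F * G * 2 * (c * c) / (\<bar>x1\<bar> ^ (\<alpha> + 1) * \<bar>x2\<bar> ^ (\<beta> + 1) * \<bar>x3\<bar> ^ (\<gamma> + 1)) *
        (\<bar>x1 * x2 / x3\<bar> + \<bar>x3 / (x1 * x2)\<bar>) powr (- \<theta>)"
      by (simp add: E_def abs_mult mult_ac)
  qed
qed

section \<open>Cancellation over shells\<close>

lemma norm_set_integral_le:
  fixes f :: "'a \<Rightarrow> 'b::{banach, second_countable_topology}"
  assumes A: "A \<in> sets M" "emeasure M A < \<infinity>" and f: "\<And>x. x \<in> A \<Longrightarrow> norm (f x) \<le> B" and B: "0 \<le> B"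
  shows "norm (LINT x:A|M. f x) \<le> B * measure M A"
proof (cases "set_integrable M A f")
  case True
  have iB: "integrable M (\<lambda>x. indicator A x * B)" using A by (intro integrable_mult_left) auto
  have "norm (LINT x:A|M. f x) \<le> (\<integral>x. norm (indicator A x *\<^sub>R f x) \<partial>M)"
    unfolding set_lebesgue_integral_def by (rule integral_norm_bound)
  also have "\<dots> \<le> (\<integral>x. indicator A x * B \<partial>M)"
    using True f iB by (intro integral_mono integrable_norm) (auto simp: set_integrable_def indicator_def)
  also have "\<dots> = B * measure M A" using A by simp
  finally show ?thesis .
next
  case False
  thus ?thesis using B by (simp add: set_lebesgue_integral_def set_integrable_def not_integrable_integral_eq)
qed

lemma set_integrable_bounded_continuous:
  fixes f :: "'a::euclidean_space \<Rightarrow> complex"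
  assumes "continuous_on UNIV f" "\<And>x. cmod (f x) \<le> B" "A \<in> sets borel" "emeasure lborel A < \<infinity>"
  shows "set_integrable lborel A f"
  unfolding set_integrable_def
  by (rule integrableI_bounded_set_indicator[where B = B])
     (use assms in \<open>auto intro: borel_measurable_continuous_onI\<close>)

text \<open>
  A shell is a closed centred interval minus an open one, so the endpoints are left free.
\<close>

definition centred_interval :: "real \<Rightarrow> real set \<Rightarrow> bool" where
  "centred_interval t A \<longleftrightarrow> A \<in> sets borel \<and> {-t<..<t} \<subseteq> A \<and> A \<subseteq> {-t..t}"

lemma fmeasurable_Icc: "{a..b::real} \<in> fmeasurable lborel"
  by (rule fmeasurableI) (auto simp: emeasure_lborel_Icc_eq)

lemma emeasure_Int_Icc: "emeasure lborel (S \<inter> {a..b::real}) < \<infinity>"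
proof -
  have "emeasure lborel (S \<inter> {a..b}) \<le> emeasure lborel {a..b}" by (intro emeasure_mono) auto
  also have "\<dots> < \<infinity>" by (simp add: emeasure_lborel_Icc_eq)
  finally show ?thesis .
qed

lemma centred_interval_emeasure:
  assumes "centred_interval t A" "0 < t"
  shows "emeasure lborel A < \<infinity>" "measure lborel A \<le> 2 * t"
proof -
  have "emeasure lborel A \<le> emeasure lborel {-t..t}"
    using assms by (intro emeasure_mono) (auto simp: centred_interval_def)
  thus "emeasure lborel A < \<infinity>" using assms by (auto intro: le_less_trans)
  have "measure lborel A \<le> measure lborel {-t..t}"
    using assms by (intro measure_mono_fmeasurable fmeasurable_Icc) (auto simp: centred_interval_def)
  thus "measure lborel A \<le> 2 * t" using assms by simp
qed

lemma shell_sets [measurable]: "shell \<delta> r \<in> sets borel"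
  unfolding shell_def by measurable

lemma shell_subset: "shell \<delta> r \<subseteq> {-r..r}"
  by (auto simp: shell_def)

lemma shell_nonzero: "x \<in> shell \<delta> r \<Longrightarrow> 0 < \<delta> \<Longrightarrow> x \<noteq> 0"
  by (auto simp: shell_def)

lemma emeasure_shell: "emeasure lborel (shell \<delta> r) < \<infinity>"
proof -
  have "emeasure lborel (shell \<delta> r) \<le> emeasure lborel {-r..r}"
    by (intro emeasure_mono shell_subset) auto
  also have "\<dots> < \<infinity>" by (simp add: emeasure_lborel_Icc_eq)
  finally show ?thesis .
qed

lemma centred_intervals_of_shell:
  "centred_interval r {-r..r}" "centred_interval r {-r<..<r}"
  by (auto simp: centred_interval_def)

lemma indicator_shell:
  assumes "\<delta> \<le> r" "0 < \<delta>"
  shows "indicator (shell \<delta> r) x = (indicator {-r..r} x - indicator {-\<delta><..<\<delta>} x :: real)"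
  using assms by (auto simp: shell_def indicator_def)

text \<open>
  For \<open>a * t \<le> 1\<close> the length of the interval is enough.  For \<open>a * t > 1\<close> the interval contains the
  support of the dilated bump, and the integral is that of \<open>f\<close> over the line, up to a factor.
\<close>

lemma dilated_bump_integral_le:
  fixes f :: "real \<Rightarrow> complex"
  assumes f: "bump f" and F: "\<And>x. cmod (f x) \<le> F" and mean: "(LINT x|lborel. f x) = 0"
    and A: "centred_interval t A" and pos: "0 < t" "0 < a"
  shows "a * cmod (LINT x:A|lborel. f (a * x)) \<le> 2 * F * trunc_pow 1 (a * t)"
proof (cases "a * t \<le> 1")
  case True
  have F0: "0 \<le> F" using F norm_ge_zero order_trans by blast
  have "cmod (LINT x:A|lborel. f (a * x)) \<le> F * measure lborel A"
    using A centred_interval_emeasure[OF A pos(1)] F F0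
    by (intro norm_set_integral_le) (auto simp: centred_interval_def)
  also have "\<dots> \<le> F * (2 * t)" using centred_interval_emeasure[OF A pos(1)] F0 by (intro mult_left_mono) auto
  finally have "a * cmod (LINT x:A|lborel. f (a * x)) \<le> a * (F * (2 * t))" using pos by (intro mult_left_mono) auto
  thus ?thesis using True pos by (simp add: trunc_pow_def mult_ac)
next
  case False
  have "indicator A x *\<^sub>R f (a * x) = f (a * x)" for x
  proof (cases "x \<in> A")
    case False
    hence "t \<le> \<bar>x\<bar>" using A by (force simp: centred_interval_def)
    hence "a * t \<le> a * \<bar>x\<bar>" using pos by (intro mult_left_mono) auto
    hence "1 < a * \<bar>x\<bar>" using \<open>\<not> a * t \<le> 1\<close> by linarith
    hence "1 < norm (a * x)" using pos by (simp add: abs_mult)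
    thus ?thesis using f by (auto simp: bump_def)
  qed simp
  hence "(LINT x:A|lborel. f (a * x)) = (LINT x|lborel. f (a * x))"
    by (simp add: set_lebesgue_integral_def)
  also have "\<dots> = 0" using lborel_integral_real_affine[of a f 0] pos mean by simp
  finally show ?thesis using False by (simp add: trunc_pow_def)
qed

lemma shell_integral_le:
  fixes f :: "real \<Rightarrow> complex"
  assumes f: "bump f" and F: "\<And>x. cmod (f x) \<le> F" and mean: "(LINT x|lborel. f x) = 0"
    and pos: "0 < \<delta>" "0 < r" "0 < a"
  shows "a * cmod (LINT x:shell \<delta> r|lborel. f (a * x)) \<le> 2 * F * (trunc_pow 1 (a * r) + trunc_pow 1 (a * \<delta>))"
proof (cases "\<delta> \<le> r")
  case True
  let ?I = "\<lambda>A. LINT x:A|lborel. f (a * x)"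
  have cont: "continuous_on UNIV (\<lambda>x. f (a * x))"
    by (rule continuous_on_compose2[OF bump_continuous[OF f]]) (auto intro!: continuous_intros)
  have int: "set_integrable lborel A (\<lambda>x. f (a * x))" if "centred_interval t A" "0 < t" for t A
    by (rule set_integrable_bounded_continuous[OF cont F])
       (use that centred_interval_emeasure in \<open>auto simp: centred_interval_def\<close>)
  note c = centred_intervals_of_shell(1)[of r] centred_intervals_of_shell(2)[of \<delta>]
  have "?I (shell \<delta> r) = ?I {-r..r} - ?I {-\<delta><..<\<delta>}"
    using int[OF c(1) pos(2)] int[OF c(2) pos(1)] True pos
    by (simp add: set_lebesgue_integral_def set_integrable_def indicator_shell scaleR_diff_left)
  hence "a * cmod (?I (shell \<delta> r)) \<le> a * cmod (?I {-r..r}) + a * cmod (?I {-\<delta><..<\<delta>})"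
    using pos by (simp add: norm_triangle_ineq4 flip: distrib_left)
  also have "\<dots> \<le> 2 * F * trunc_pow 1 (a * r) + 2 * F * trunc_pow 1 (a * \<delta>)"
    using pos by (intro add_mono dilated_bump_integral_le f F mean c)
  finally show ?thesis by (simp add: algebra_simps)
next
  case False
  have "0 \<le> F" using F norm_ge_zero order_trans by blast
  moreover from False have "shell \<delta> r = {}" by (auto simp: shell_def)
  ultimately show ?thesis by (simp add: trunc_pow_nonneg set_lebesgue_integral_def)
qed

lemma emeasure_lborel_Times:
  fixes A :: "'a::euclidean_space set" and B :: "'b::euclidean_space set"
  assumes "A \<in> sets borel" "B \<in> sets borel"
  shows "emeasure lborel (A \<times> B) = emeasure lborel A * emeasure lborel B"
  using lborel.emeasure_pair_measure_Times[of A lborel B] assms by (simp add: lborel_prod)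

lemma measure_lborel_Times:
  fixes A :: "'a::euclidean_space set" and B :: "'b::euclidean_space set"
  assumes "A \<in> sets borel" "B \<in> sets borel"
  shows "measure lborel (A \<times> B) = measure lborel A * measure lborel B"
  using emeasure_lborel_Times[OF assms] by (simp add: measure_def enn2real_mult)

lemma Times_borel_finite:
  fixes A :: "'a::euclidean_space set" and B :: "'b::euclidean_space set"
  assumes "A \<in> sets borel" "B \<in> sets borel" "emeasure lborel A < \<infinity>" "emeasure lborel B < \<infinity>"
  shows "A \<times> B \<in> sets borel" "emeasure lborel (A \<times> B) < \<infinity>"
  using assms by (auto simp: emeasure_lborel_Times ennreal_mult_less_top borel_Times)

lemma dilation_continuous:
  fixes g :: "real \<times> real \<Rightarrow> complex"
  assumes "bump g"
  shows "continuous_on UNIV (\<lambda>y. g (b * fst y, d * snd y))"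
  by (rule continuous_on_compose2[OF bump_continuous[OF assms]]) (auto intro!: continuous_intros)

lemma dilated_bump_integrable:
  fixes g :: "real \<times> real \<Rightarrow> complex"
  assumes g: "bump g" and "0 < b" "0 < d"
  shows "integrable lborel (\<lambda>y. g (b * fst y, d * snd y))"
proof -
  obtain G where G: "\<And>x. cmod (g x) \<le> G" using bump_bounded[OF g] by blast
  have "integrable lborel (\<lambda>y. indicator ({-(1/b)..1/b} \<times> {-(1/d)..1/d}) y *\<^sub>R g (b * fst y, d * snd y))"
    using set_integrable_bounded_continuous[OF dilation_continuous[OF g] G
        Times_borel_finite[of "{-(1/b)..1/b}" "{-(1/d)..1/d}"], of b d]
    by (simp add: set_integrable_def emeasure_lborel_Icc_eq)
  moreover have "indicator ({-(1/b)..1/b} \<times> {-(1/d)..1/d}) y *\<^sub>R g (b * fst y, d * snd y) = g (b * fst y, d * snd y)" for y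
  proof (cases "g (b * fst y, d * snd y) = 0")
    case False
    hence "\<bar>b * fst y\<bar> \<le> 1" "\<bar>d * snd y\<bar> \<le> 1"
      using bump_pair_eq_0[OF g] by (meson not_le)+
    hence "\<bar>fst y\<bar> \<le> 1 / b" "\<bar>snd y\<bar> \<le> 1 / d" using assms by (auto simp: abs_mult field_simps)
    hence "y \<in> {-(1/b)..1/b} \<times> {-(1/d)..1/d}" by (cases y) (auto simp: abs_le_iff)
    thus ?thesis by simp
  qed simp
  ultimately show ?thesis by simp
qed

lemma dilated_bump_integral_prod_eq_0:
  fixes g :: "real \<times> real \<Rightarrow> complex"
  assumes g: "bump g" and bd: "0 < b" "0 < d" and mean: "(LINT y|lborel. g y) = 0"
  shows "(LINT y|lborel. g (b * fst y, d * snd y)) = 0"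
proof -
  have fub: "(LINT y|lborel. g (p * fst y, q * snd y)) = (LINT u|lborel. LINT v|lborel. g (p * u, q * v))"
    if "0 < p" "0 < q" for p q
    using lborel_pair.integral_fst'[of "\<lambda>y. g (p * fst y, q * snd y)"] dilated_bump_integrable[OF g that]
    by (simp add: lborel_prod)
  have "(LINT u|lborel. LINT v|lborel. g (b * u, d * v)) = (LINT u|lborel. (1 / d) *\<^sub>R (LINT v|lborel. g (b * u, v)))"
    using lborel_integral_real_affine[of d "\<lambda>v. g (b * u, v)" 0 for u] bd by simp
  also have "\<dots> = (1 / d) *\<^sub>R (LINT u|lborel. LINT v|lborel. g (b * u, v))" by simp
  also have "(LINT u|lborel. LINT v|lborel. g (b * u, v)) = (1 / b) *\<^sub>R (LINT u|lborel. LINT v|lborel. g (u, v))"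
    using lborel_integral_real_affine[of b "\<lambda>u. LINT v|lborel. g (u, v)" 0] bd by simp
  also have "(LINT u|lborel. LINT v|lborel. g (u, v)) = 0" using fub[of 1 1] mean by simp
  finally show ?thesis using fub[OF bd] by simp
qed

text \<open>
  If \<open>b * s \<le> 1\<close>, the rectangle meets the support in a set of measure at most
  \<open>2 * s * (2 / d)\<close>; similarly if \<open>d * t \<le> 1\<close>.  If both fail, the rectangle contains the support and
  the mean of \<open>g\<close> decides.  The sum on the right, in place of a minimum, suffices, as
  each summand is separately summable over the scales.
\<close>

lemma dilated_bump_integral_prod_le:
  fixes g :: "real \<times> real \<Rightarrow> complex"
  assumes g: "bump g" and G: "\<And>x. cmod (g x) \<le> G" and mean: "(LINT y|lborel. g y) = 0"
    and A: "centred_interval s A" and B: "centred_interval t B" and pos: "0 < s" "0 < t" "0 < b" "0 < d"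
  shows "b * d * cmod (LINT y:A \<times> B|lborel. g (b * fst y, d * snd y)) \<le>
    4 * G * (trunc_pow 1 (b * s) + trunc_pow 1 (d * t))"
proof -
  have G0: "0 \<le> G" using G norm_ge_zero order_trans by blast
  have AB: "A \<in> sets borel" "B \<in> sets borel" using A B by (auto simp: centred_interval_def)
  let ?g = "\<lambda>y. g (b * fst y, d * snd y)"
  have g0: "?g (x, y) = 0" if "1 / b < \<bar>x\<bar> \<or> 1 / d < \<bar>y\<bar>" for x y
  proof -
    have "1 < \<bar>b * x\<bar> \<or> 1 < \<bar>d * y\<bar>" using that pos by (auto simp: abs_mult field_simps)
    thus ?thesis using bump_pair_eq_0[OF g] by simp
  qed
  have supp: "\<bar>x\<bar> \<le> 1 / b \<and> \<bar>y\<bar> \<le> 1 / d" if "?g (x, y) \<noteq> 0" for x y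
    using g0[of x y] that by linarith
  \<comment> \<open>a side that exceeds the support may be cut down to it\<close>
  have restrict: "(LINT y:A \<times> B|lborel. ?g y) = (LINT y:A' \<times> B'|lborel. ?g y)"
    if "\<And>x y. ?g (x, y) \<noteq> 0 \<Longrightarrow> (x, y) \<in> A \<times> B \<longleftrightarrow> (x, y) \<in> A' \<times> B'" for A' B'
    unfolding set_lebesgue_integral_def
    by (intro Bochner_Integration.integral_cong refl) (use that in \<open>force simp: indicator_def\<close>)
  have bound: "cmod (LINT y:A' \<times> B'|lborel. ?g y) \<le> G * (measure lborel A' * measure lborel B')"
    if "A' \<in> sets borel" "B' \<in> sets borel" "emeasure lborel A' < \<infinity>" "emeasure lborel B' < \<infinity>"
    for A' B' :: "real set"
    unfolding measure_lborel_Times[OF that(1,2), symmetric]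
    using Times_borel_finite[OF that] G G0 by (intro norm_set_integral_le) auto
  consider "b * s \<le> 1" | "1 < b * s" "d * t \<le> 1" | "1 < b * s" "1 < d * t" by linarith
  thus ?thesis
  proof cases
    case 1
    have "(LINT y:A \<times> B|lborel. ?g y) = (LINT y:A \<times> (B \<inter> {-(1/d)..1/d})|lborel. ?g y)"
      using supp by (intro restrict) (auto simp: abs_le_iff minus_le_iff)
    also have "cmod \<dots> \<le> G * (measure lborel A * measure lborel (B \<inter> {-(1/d)..1/d}))"
      using AB centred_interval_emeasure(1)[OF A pos(1)]
      by (intro bound emeasure_Int_Icc) auto
    also have "\<dots> \<le> G * (2 * s * (2 / d))"
    proof (intro mult_left_mono mult_mono)
      have "measure lborel (B \<inter> {-(1/d)..1/d}) \<le> measure lborel {-(1/d)..1/d}"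
        using AB by (intro measure_mono_fmeasurable fmeasurable_Icc) auto
      thus "measure lborel (B \<inter> {-(1/d)..1/d}) \<le> 2 / d" using pos by simp
    qed (use centred_interval_emeasure(2)[OF A pos(1)] pos G0 in auto)
    finally have "b * d * cmod (LINT y:A \<times> B|lborel. ?g y) \<le> b * d * (G * (2 * s * (2 / d)))"
      using pos by (intro mult_left_mono) auto
    also have "\<dots> = 4 * G * trunc_pow 1 (b * s)" using 1 pos by (simp add: trunc_pow_def)
    also have "\<dots> \<le> 4 * G * (trunc_pow 1 (b * s) + trunc_pow 1 (d * t))"
      using G0 by (intro mult_left_mono) (auto simp: trunc_pow_nonneg)
    finally show ?thesis .
  next
    case 2
    have "(LINT y:A \<times> B|lborel. ?g y) = (LINT y:(A \<inter> {-(1/b)..1/b}) \<times> B|lborel. ?g y)"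
      using supp by (intro restrict) (auto simp: abs_le_iff minus_le_iff)
    also have "cmod \<dots> \<le> G * (measure lborel (A \<inter> {-(1/b)..1/b}) * measure lborel B)"
      using AB centred_interval_emeasure(1)[OF B pos(2)]
      by (intro bound emeasure_Int_Icc) auto
    also have "\<dots> \<le> G * (2 / b * (2 * t))"
    proof (intro mult_left_mono mult_mono)
      have "measure lborel (A \<inter> {-(1/b)..1/b}) \<le> measure lborel {-(1/b)..1/b}"
        using AB by (intro measure_mono_fmeasurable fmeasurable_Icc) auto
      thus "measure lborel (A \<inter> {-(1/b)..1/b}) \<le> 2 / b" using pos by simp
    qed (use centred_interval_emeasure(2)[OF B pos(2)] pos G0 in auto)
    finally have "b * d * cmod (LINT y:A \<times> B|lborel. ?g y) \<le> b * d * (G * (2 / b * (2 * t)))"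
      using pos by (intro mult_left_mono) auto
    also have "\<dots> = 4 * G * trunc_pow 1 (d * t)" using 2 pos by (simp add: trunc_pow_def)
    also have "\<dots> \<le> 4 * G * (trunc_pow 1 (b * s) + trunc_pow 1 (d * t))"
      using G0 by (intro mult_left_mono) (auto simp: trunc_pow_nonneg)
    finally show ?thesis .
  next
    case 3
    have st: "1 / b < s" "1 / d < t" using 3 pos by (auto simp: field_simps)
    have "(LINT y:A \<times> B|lborel. ?g y) = (LINT y|lborel. ?g y)"
      unfolding set_lebesgue_integral_def
    proof (intro Bochner_Integration.integral_cong refl)
      fix y :: "real \<times> real"
      obtain u v where y: "y = (u, v)" by (metis prod.exhaust)
      show "indicator (A \<times> B) y *\<^sub>R ?g y = ?g y"
      proof (cases "?g y = 0")
        case False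
        hence "\<bar>u\<bar> \<le> 1 / b" "\<bar>v\<bar> \<le> 1 / d" using g0[of u v] y by (meson not_le)+
        hence "u \<in> {-s<..<s}" "v \<in> {-t<..<t}" using st by auto
        hence "y \<in> A \<times> B" using A B y by (auto simp: centred_interval_def)
        thus ?thesis by simp
      qed simp
    qed
    also have "\<dots> = 0" using dilated_bump_integral_prod_eq_0[OF g pos(3,4) mean] .
    finally show ?thesis using G0 by (simp add: trunc_pow_nonneg)
  qed
qed

lemma norm_four_term_le:
  fixes w p q r s :: complex
  assumes "w = p - q - (r - s)" "0 \<le> c" "c * cmod p \<le> P" "c * cmod q \<le> Q" "c * cmod r \<le> R" "c * cmod s \<le> S"
  shows "c * cmod w \<le> P + Q + (R + S)"
proof -
  have "cmod w \<le> (cmod p + cmod q) + (cmod r + cmod s)"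
    unfolding assms(1) by (intro order_trans[OF norm_triangle_ineq4] add_mono norm_triangle_ineq4)
  hence "c * cmod w \<le> c * ((cmod p + cmod q) + (cmod r + cmod s))"
    by (rule mult_left_mono) fact
  thus ?thesis using assms(3-6) by (simp add: distrib_left)
qed

text \<open>
  The product of two shells is a signed combination of four rectangles.
\<close>

lemma shell_integral_prod_le:
  fixes g :: "real \<times> real \<Rightarrow> complex"
  assumes g: "bump g" and G: "\<And>x. cmod (g x) \<le> G" and mean: "(LINT y|lborel. g y) = 0"
    and pos: "0 < \<delta>1" "0 < r1" "0 < \<delta>2" "0 < r2" "0 < b" "0 < d"
  shows "b * d * cmod (LINT y:shell \<delta>1 r1 \<times> shell \<delta>2 r2|lborel. g (b * fst y, d * snd y)) \<le>
    8 * G * (trunc_pow 1 (b * r1) + trunc_pow 1 (b * \<delta>1) + trunc_pow 1 (d * r2) + trunc_pow 1 (d * \<delta>2))"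
proof (cases "\<delta>1 \<le> r1 \<and> \<delta>2 \<le> r2")
  case True
  let ?I = "\<lambda>A B. LINT y:A \<times> B|lborel. g (b * fst y, d * snd y)"
  have int: "integrable lborel (\<lambda>y. indicator (A \<times> B) y *\<^sub>R g (b * fst y, d * snd y))"
    if "centred_interval s A" "0 < s" "centred_interval t B" "0 < t" for s t A B
    unfolding set_integrable_def[symmetric]
    by (rule set_integrable_bounded_continuous[OF dilation_continuous[OF g] G Times_borel_finite])
       (use that centred_interval_emeasure in \<open>auto simp: centred_interval_def\<close>)
  note c = centred_intervals_of_shell
  have ind: "indicator (shell \<delta>1 r1 \<times> shell \<delta>2 r2) y =
     (indicator ({-r1..r1} \<times> {-r2..r2}) y - indicator ({-r1..r1} \<times> {-\<delta>2<..<\<delta>2}) y -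
      (indicator ({-\<delta>1<..<\<delta>1} \<times> {-r2..r2}) y - indicator ({-\<delta>1<..<\<delta>1} \<times> {-\<delta>2<..<\<delta>2}) y) :: real)" for y
  proof -
    have "indicator (shell \<delta>1 r1) (fst y) = (indicator {-r1..r1} (fst y) - indicator {-\<delta>1<..<\<delta>1} (fst y) :: real)"
      "indicator (shell \<delta>2 r2) (snd y) = (indicator {-r2..r2} (snd y) - indicator {-\<delta>2<..<\<delta>2} (snd y) :: real)"
      using True pos by (auto intro: indicator_shell)
    thus ?thesis unfolding indicator_times by (simp only:) (simp add: algebra_simps)
  qed
  have split: "?I (shell \<delta>1 r1) (shell \<delta>2 r2) =
      ?I {-r1..r1} {-r2..r2} - ?I {-r1..r1} {-\<delta>2<..<\<delta>2} -
      (?I {-\<delta>1<..<\<delta>1} {-r2..r2} - ?I {-\<delta>1<..<\<delta>1} {-\<delta>2<..<\<delta>2})"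
    unfolding set_lebesgue_integral_def ind scaleR_diff_left
    using int[OF c(1)[of r1] pos(2) c(1)[of r2] pos(4)] int[OF c(1)[of r1] pos(2) c(2)[of \<delta>2] pos(3)]
      int[OF c(2)[of \<delta>1] pos(1) c(1)[of r2] pos(4)] int[OF c(2)[of \<delta>1] pos(1) c(2)[of \<delta>2] pos(3)]
    by simp
  have "b * d * cmod (?I (shell \<delta>1 r1) (shell \<delta>2 r2)) \<le>
      4 * G * (trunc_pow 1 (b * r1) + trunc_pow 1 (d * r2)) + 4 * G * (trunc_pow 1 (b * r1) + trunc_pow 1 (d * \<delta>2)) +
      (4 * G * (trunc_pow 1 (b * \<delta>1) + trunc_pow 1 (d * r2)) + 4 * G * (trunc_pow 1 (b * \<delta>1) + trunc_pow 1 (d * \<delta>2)))"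
    using pos by (intro norm_four_term_le[OF split] dilated_bump_integral_prod_le[OF g G mean] c) auto
  thus ?thesis by (simp add: algebra_simps)
next
  case False
  have "0 \<le> G" using G norm_ge_zero order_trans by blast
  moreover from False have empty: "shell \<delta>1 r1 \<times> shell \<delta>2 r2 = {}" by (auto simp: shell_def)
  ultimately show ?thesis unfolding empty by (simp add: trunc_pow_nonneg set_lebesgue_integral_def)
qed

section \<open>Integrals of multiscale sums\<close>

lemma set_integral_product:
  fixes u :: "'a::euclidean_space \<Rightarrow> complex" and v :: "'b::euclidean_space \<Rightarrow> complex"
  assumes u: "set_integrable lborel A u" and v: "set_integrable lborel B v"
  shows "(LINT x:A \<times> B|lborel. u (fst x) * v (snd x)) = (LINT x:A|lborel. u x) * (LINT y:B|lborel. v y)"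
proof -
  define U V where "U x = indicator A x *\<^sub>R u x" and "V y = indicator B y *\<^sub>R v y" for x y
  have UV: "integrable lborel U" "integrable lborel V"
    using u v by (simp_all add: set_integrable_def U_def[abs_def] V_def[abs_def])
  hence meas [measurable]: "U \<in> borel_measurable lborel" "V \<in> borel_measurable lborel" by auto
  have int: "integrable (lborel \<Otimes>\<^sub>M lborel) (\<lambda>z. U (fst z) * V (snd z))"
  proof (rule lborel_pair.Fubini_integrable)
    show "(\<lambda>z. U (fst z) * V (snd z)) \<in> borel_measurable (lborel \<Otimes>\<^sub>M lborel)" by measurable
    show "integrable lborel (\<lambda>x. \<integral>y. norm (U (fst (x, y)) * V (snd (x, y))) \<partial>lborel)"
      using UV by (simp add: norm_mult)
    show "AE x in lborel. integrable lborel (\<lambda>y. U (fst (x, y)) * V (snd (x, y)))"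
      using UV by simp
  qed
  have "(LINT x:A \<times> B|lborel. u (fst x) * v (snd x)) = (LINT z|lborel. U (fst z) * V (snd z))"
    unfolding set_lebesgue_integral_def U_def V_def
    by (intro Bochner_Integration.integral_cong refl) (auto simp: indicator_times)
  also have "\<dots> = (LINT x|lborel. LINT y|lborel. U x * V y)"
    using lborel_pair.integral_fst'[OF int] by (simp add: lborel_prod)
  also have "\<dots> = (LINT x|lborel. U x) * (LINT y|lborel. V y)" by simp
  finally show ?thesis by (simp add: set_lebesgue_integral_def U_def V_def)
qed

lemma set_borel_measurable_continuous:
  fixes f :: "'a::euclidean_space \<Rightarrow> complex"
  assumes "continuous_on UNIV f" "A \<in> sets borel"
  shows "set_borel_measurable lborel A f"
  using borel_measurable_continuous_onI[OF assms(1)] assms(2) unfolding set_borel_measurable_def by simp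

lemma multiscale_term_continuous:
  fixes f :: "real \<Rightarrow> complex" and g :: "real \<times> real \<Rightarrow> complex"
  assumes "bump f" "bump g"
  shows "continuous_on UNIV (\<lambda>x. multiscale_term m n f g x i)"
  using has_derivative_continuous[OF multiscale_term_has_derivative[OF assms]]
  by (simp add: continuous_at_imp_continuous_on)

text \<open>
  The weight \<open>a\<^sup>2 b\<^sup>2\<close> is exactly the product of the normalisations \<open>a\<close> of the first and
  \<open>b * (a * b)\<close> of the second bump, so each term is a product of two normalised shell integrals.
  The one in the plane is summable over \<open>k\<close> uniformly in \<open>j\<close>, the other over \<open>j\<close>.
\<close>

lemma multiscale_sum_box_integral_bound:
  fixes f :: "real \<Rightarrow> complex" and g :: "real \<times> real \<Rightarrow> complex"
  assumes f: "bump f" and g: "bump g"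
    and meanf: "(LINT x|lborel. f x) = 0" and meang: "(LINT y|lborel. g y) = 0"
  shows "\<exists>C. \<forall>\<delta>1 \<delta>2 \<delta>3 r1 r2 r3.
    0 < \<delta>1 \<and> 0 < \<delta>2 \<and> 0 < \<delta>3 \<and> 0 < r1 \<and> 0 < r2 \<and> 0 < r3 \<longrightarrow>
    cmod (LINT x:shell \<delta>1 r1 \<times> shell \<delta>2 r2 \<times> shell \<delta>3 r3|lborel. multiscale_sum 2 2 f g x) \<le> C"
proof -
  obtain F where F: "0 < F" "\<And>x. cmod (f x) \<le> F" using bump_bounded[OF f] by blast
  obtain G where G: "0 < G" "\<And>x. cmod (g x) \<le> G" using bump_bounded[OF g] by blast
  obtain e :: "nat \<Rightarrow> int \<times> int" where e: "bij e" using ex_bij_nat_int_prod by blast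
  define c where "c = dyadic_const 1"
  show ?thesis
  proof (intro exI[of _ "2 * F * (8 * G) * ((c + c) * (c + c + c + c))"] allI impI)
    fix \<delta>1 \<delta>2 \<delta>3 r1 r2 r3 :: real
    assume "0 < \<delta>1 \<and> 0 < \<delta>2 \<and> 0 < \<delta>3 \<and> 0 < r1 \<and> 0 < r2 \<and> 0 < r3"
    hence pos: "0 < \<delta>1" "0 < \<delta>2" "0 < \<delta>3" "0 < r1" "0 < r2" "0 < r3" by auto
    let ?A = "shell \<delta>1 r1" and ?B = "shell \<delta>2 r2 \<times> shell \<delta>3 r3"
    have B: "?B \<in> sets borel" "emeasure lborel ?B < \<infinity>"
      by (intro Times_borel_finite shell_sets emeasure_shell)+
    have AB: "?A \<times> ?B \<in> sets borel" "emeasure lborel (?A \<times> ?B) < \<infinity>"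
      using B by (intro Times_borel_finite shell_sets emeasure_shell; simp)+
    obtain M C where M: "bounded_sum M C"
      "\<And>x i. \<delta>1 \<le> \<bar>fst x\<bar> \<Longrightarrow> \<delta>2 \<le> \<bar>fst (snd x)\<bar> \<Longrightarrow> cmod (multiscale_term 2 2 f g x i) \<le> M i"
      using multiscale_term_bounded_sum[OF f g, of 2 2 \<delta>1 \<delta>2] pos by auto
    define X where "X j = trunc_pow 1 (2 powi j * r1) + trunc_pow 1 (2 powi j * \<delta>1)" for j :: int
    \<comment> \<open>the second coordinate of \<open>g\<close> is dilated by \<open>2 powi j * 2 powi k\<close>, hence the moving radii\<close>
    define Y where "Y j k = trunc_pow 1 (2 powi k * r2) + trunc_pow 1 (2 powi k * \<delta>2) +
       trunc_pow 1 (2 powi k * (2 powi j * r3)) + trunc_pow 1 (2 powi k * (2 powi j * \<delta>3))" for j k :: int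
    define N where "N = (\<lambda>i. 2 * F * (8 * G) * (case i of (j, k) \<Rightarrow> X j * Y j k))"
    have "bounded_sum X (c + c)" "\<And>j. bounded_sum (Y j) (c + c + c + c)"
      unfolding X_def Y_def c_def using pos by (intro bounded_sum_add bounded_sum_trunc_pow; simp)+
    hence N: "bounded_sum N (2 * F * (8 * G) * ((c + c) * (c + c + c + c)))"
      unfolding N_def using F(1) G(1) by (intro bounded_sum_cmult bounded_sum_product) auto
    show "cmod (LINT x:?A \<times> ?B|lborel. multiscale_sum 2 2 f g x) \<le> 2 * F * (8 * G) * ((c + c) * (c + c + c + c))"
      unfolding multiscale_sum_def
    proof (rule norm_integral_infsum_le[OF e _ AB(2) _ M(1) _ N])
      show "?A \<times> ?B \<in> sets lborel" using AB(1) by simp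
      show "set_borel_measurable lborel (?A \<times> ?B) (\<lambda>x. multiscale_term 2 2 f g x i)" for i
        by (rule set_borel_measurable_continuous[OF multiscale_term_continuous[OF f g] AB(1)])
      show "cmod (multiscale_term 2 2 f g x i) \<le> M i" if "x \<in> ?A \<times> ?B" for i x
        using that by (intro M(2)) (auto simp: shell_def)
      fix i :: "int \<times> int"
      obtain j k where i: "i = (j, k)" by (metis prod.exhaust)
      define a b :: real where "a = 2 powi j" and "b = 2 powi k"
      have ab: "0 < a" "0 < b" by (auto simp: a_def b_def)
      let ?If = "LINT x:?A|lborel. f (a * x)" and ?Ig = "LINT y:?B|lborel. g (b * fst y, a * b * snd y)"
      have "set_integrable lborel ?A (\<lambda>x. f (a * x))"
        by (rule set_integrable_bounded_continuous[OF _ F(2) shell_sets emeasure_shell])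
           (auto intro!: continuous_on_compose2[OF bump_continuous[OF f]] continuous_intros)
      moreover have "set_integrable lborel ?B (\<lambda>y. g (b * fst y, a * b * snd y))"
        by (rule set_integrable_bounded_continuous[OF dilation_continuous[OF g] G(2) B])
      ultimately have "(LINT x:?A \<times> ?B|lborel. f (a * fst x) * g (b * fst (snd x), a * b * snd (snd x))) = ?If * ?Ig"
        by (rule set_integral_product)
      moreover have "(LINT x:?A \<times> ?B|lborel. multiscale_term 2 2 f g x i) =
          of_real (a ^ 2 * b ^ 2) * (LINT x:?A \<times> ?B|lborel. f (a * fst x) * g (b * fst (snd x), a * b * snd (snd x)))"
        by (simp add: multiscale_term_def i a_def b_def mult.assoc flip: set_integral_mult_right)
      ultimately have "cmod (LINT x:?A \<times> ?B|lborel. multiscale_term 2 2 f g x i) =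
          cmod (of_real (a ^ 2 * b ^ 2)) * (cmod ?If * cmod ?Ig)"
        by (simp only: norm_mult)
      also have "cmod (of_real (a ^ 2 * b ^ 2)) = a ^ 2 * b ^ 2" by (simp only: norm_of_real) simp
      also have "a ^ 2 * b ^ 2 * (cmod ?If * cmod ?Ig) = (a * cmod ?If) * (b * (a * b) * cmod ?Ig)"
        by (simp add: power2_eq_square mult_ac)
      also have "\<dots> \<le> (2 * F * X j) * (8 * G * Y j k)"
      proof (rule mult_mono)
        show "a * cmod ?If \<le> 2 * F * X j"
          unfolding X_def a_def[symmetric] by (rule shell_integral_le[OF f F(2) meanf pos(1,4) ab(1)])
        have "b * (a * b) * cmod ?Ig \<le> 8 * G * (trunc_pow 1 (b * r2) + trunc_pow 1 (b * \<delta>2) +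
            trunc_pow 1 (a * b * r3) + trunc_pow 1 (a * b * \<delta>3))"
          using ab by (intro shell_integral_prod_le[OF g G(2) meang] pos) auto
        thus "b * (a * b) * cmod ?Ig \<le> 8 * G * Y j k"
          unfolding Y_def a_def[symmetric] b_def[symmetric] by (simp add: mult_ac)
      qed (use ab F(1) in \<open>auto simp: X_def trunc_pow_nonneg\<close>)
      also have "\<dots> = N i" by (simp add: N_def i)
      finally show "cmod (LINT x:?A \<times> ?B|lborel. multiscale_term 2 2 f g x i) \<le> N i" .
    qed
  qed
qed

text \<open>
  A normalised integral over the line contributes \<open>trunc_pow 1 (a * t)\<close>, which is nonzero only when
  \<open>a * t \<le> 1\<close>; then it equals \<open>a * t\<close>, and the estimate of the weight applies with \<open>X = t\<close> and
  \<open>\<alpha> = 0\<close>.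
\<close>

lemma dyadic_weight_trunc_le:
  fixes a b t Y Z \<theta> :: real
  assumes ab: "0 < a" "0 < b" and pos: "0 < t" "0 < Y" "0 < Z"
    and le: "b * Y \<le> 1" "a * b * Z \<le> 1" and \<theta>: "0 < \<theta>" "\<theta> < 1"
  shows "a ^ (1 + \<gamma>) * b ^ (2 + \<gamma> + \<beta>) * trunc_pow 1 (a * t) \<le>
    2 / (Y ^ (\<beta> + 1) * Z ^ (\<gamma> + 1)) * (t * Y / Z + Z / (t * Y)) powr (- \<theta>) *
      (trunc_pow (1 - \<theta>) (a * t) * trunc_pow (1 - \<theta>) (b * Y))"
proof (cases "a * t \<le> 1")
  case True
  have "a ^ (1 + \<gamma>) * b ^ (2 + \<gamma> + \<beta>) * trunc_pow 1 (a * t) = t * (a ^ (2 + \<gamma> + 0) * b ^ (2 + \<gamma> + \<beta>))"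
    using True ab pos by (simp add: trunc_pow_def mult_ac)
  also have "\<dots> \<le> t * (2 / (t ^ (0 + 1) * Y ^ (\<beta> + 1) * Z ^ (\<gamma> + 1)) * (t * Y / Z + Z / (t * Y)) powr (- \<theta>) *
      (trunc_pow (1 - \<theta>) (a * t) * trunc_pow (1 - \<theta>) (b * Y)))"
    using pos by (intro mult_left_mono dyadic_weight_le ab True le \<theta>) auto
  also have "\<dots> = 2 / (Y ^ (\<beta> + 1) * Z ^ (\<gamma> + 1)) * (t * Y / Z + Z / (t * Y)) powr (- \<theta>) *
      (trunc_pow (1 - \<theta>) (a * t) * trunc_pow (1 - \<theta>) (b * Y))"
    using pos by simp
  finally show ?thesis .
next
  case False
  have "0 \<le> 2 / (Y ^ (\<beta> + 1) * Z ^ (\<gamma> + 1)) * (t * Y / Z + Z / (t * Y)) powr (- \<theta>) *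
      (trunc_pow (1 - \<theta>) (a * t) * trunc_pow (1 - \<theta>) (b * Y))"
    using pos by (intro mult_nonneg_nonneg trunc_pow_nonneg) auto
  moreover have "trunc_pow 1 (a * t) = 0" using False by (simp add: trunc_pow_def)
  ultimately show ?thesis by (simp only: mult_zero_right)
qed

lemma multiscale_sum_line_integral_bound:
  fixes f :: "real \<Rightarrow> complex" and g :: "real \<times> real \<Rightarrow> complex"
  assumes f: "bump f" and g: "bump g" and mean: "(LINT x|lborel. f x) = 0" and \<theta>: "0 < \<theta>" "\<theta> < 1"
  shows "\<exists>C. \<forall>\<delta> r x2 x3. 0 < \<delta> \<and> 0 < r \<and> x2 \<noteq> 0 \<and> x3 \<noteq> 0 \<longrightarrow>
    cmod (LINT x1:shell \<delta> r|lborel. multiscale_sum (2 + \<gamma>) (2 + \<gamma> + \<beta>) f g (x1, x2, x3)) \<le>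
      C / (\<bar>x2\<bar> ^ (\<beta> + 1) * \<bar>x3\<bar> ^ (\<gamma> + 1)) *
        (1 / (\<bar>r * x2 / x3\<bar> + \<bar>x3 / (r * x2)\<bar>) powr \<theta> +
         1 / (\<bar>\<delta> * x2 / x3\<bar> + \<bar>x3 / (\<delta> * x2)\<bar>) powr \<theta>)"
proof -
  obtain F where F: "0 < F" "\<And>x. cmod (f x) \<le> F" using bump_bounded[OF f] by blast
  obtain G where G: "0 < G" "\<And>x. cmod (g x) \<le> G" using bump_bounded[OF g] by blast
  obtain e :: "nat \<Rightarrow> int \<times> int" where e: "bij e" using ex_bij_nat_int_prod by blast
  define c where "c = dyadic_const (1 - \<theta>)"
  show ?thesis
  proof (intro exI[of _ "2 * F * G * (2 * (c * c))"] allI impI)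
    fix \<delta> r x2 x3 :: real assume "0 < \<delta> \<and> 0 < r \<and> x2 \<noteq> 0 \<and> x3 \<noteq> 0"
    hence pos: "0 < \<delta>" "0 < r" and x: "x2 \<noteq> 0" "x3 \<noteq> 0" by auto
    define D where "D = 1 / (\<bar>x2\<bar> ^ (\<beta> + 1) * \<bar>x3\<bar> ^ (\<gamma> + 1))"
    define E where "E t = 2 * D * (t * \<bar>x2\<bar> / \<bar>x3\<bar> + \<bar>x3\<bar> / (t * \<bar>x2\<bar>)) powr (- \<theta>)" for t
    have E: "0 \<le> E t" for t by (simp add: E_def D_def)
    define P where "P t = (\<lambda>(j, k). trunc_pow (1 - \<theta>) (2 powi j * t) * trunc_pow (1 - \<theta>) (2 powi k * \<bar>x2\<bar>))" for t
    have P: "bounded_sum (P t) (c * c)" if "0 < t" for t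
      unfolding P_def c_def using that x \<theta> by (intro bounded_sum_product bounded_sum_trunc_pow) auto
    define N where "N i = 2 * F * G * (E r * P r i + E \<delta> * P \<delta> i)" for i
    have N: "bounded_sum N (2 * F * G * (E r * (c * c) + E \<delta> * (c * c)))"
      unfolding N_def using F(1) G(1) by (intro bounded_sum_cmult bounded_sum_add P pos E) auto
    obtain M C where M: "bounded_sum M C"
      "\<And>x i. \<delta> \<le> \<bar>fst x\<bar> \<Longrightarrow> \<bar>x2\<bar> \<le> \<bar>fst (snd x)\<bar> \<Longrightarrow> cmod (multiscale_term (2 + \<gamma>) (2 + \<gamma> + \<beta>) f g x i) \<le> M i"
      using multiscale_term_bounded_sum[OF f g, of "2 + \<gamma>" "2 + \<gamma> + \<beta>" \<delta> "\<bar>x2\<bar>"] pos x by auto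
    let ?A = "shell \<delta> r"
    have "cmod (LINT x1:?A|lborel. multiscale_sum (2 + \<gamma>) (2 + \<gamma> + \<beta>) f g (x1, x2, x3)) \<le>
        2 * F * G * (E r * (c * c) + E \<delta> * (c * c))"
      unfolding multiscale_sum_def
    proof (rule norm_integral_infsum_le[OF e _ emeasure_shell _ M(1) _ N])
      show "?A \<in> sets lborel" using shell_sets by simp
      show "set_borel_measurable lborel ?A (\<lambda>x1. multiscale_term (2 + \<gamma>) (2 + \<gamma> + \<beta>) f g (x1, x2, x3) i)" for i
        by (intro set_borel_measurable_continuous shell_sets
            continuous_on_compose2[OF multiscale_term_continuous[OF f g]] continuous_intros) auto
      show "cmod (multiscale_term (2 + \<gamma>) (2 + \<gamma> + \<beta>) f g (x1, x2, x3) i) \<le> M i" if "x1 \<in> ?A" for i x1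
        using that by (intro M(2)) (auto simp: shell_def)
      fix i :: "int \<times> int"
      obtain j k where i: "i = (j, k)" by (metis prod.exhaust)
      define a b :: real where "a = 2 powi j" and "b = 2 powi k"
      have ab: "0 < a" "0 < b" by (auto simp: a_def b_def)
      let ?If = "LINT x:?A|lborel. f (a * x)" and ?g = "g (b * x2, a * b * x3)"
      have "(LINT x1:?A|lborel. multiscale_term (2 + \<gamma>) (2 + \<gamma> + \<beta>) f g (x1, x2, x3) i) =
          of_real (a ^ (2 + \<gamma>) * b ^ (2 + \<gamma> + \<beta>)) * ?g * ?If"
        unfolding set_integral_mult_right[symmetric]
        by (simp add: multiscale_term_def i a_def b_def mult_ac)
      hence "cmod (LINT x1:?A|lborel. multiscale_term (2 + \<gamma>) (2 + \<gamma> + \<beta>) f g (x1, x2, x3) i) =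
          cmod (of_real (a ^ (2 + \<gamma>) * b ^ (2 + \<gamma> + \<beta>))) * cmod ?g * cmod ?If"
        by (simp only: norm_mult)
      also have "cmod (of_real (a ^ (2 + \<gamma>) * b ^ (2 + \<gamma> + \<beta>))) = a ^ (2 + \<gamma>) * b ^ (2 + \<gamma> + \<beta>)"
        using ab by (simp only: norm_of_real) simp
      also have "a ^ (2 + \<gamma>) * b ^ (2 + \<gamma> + \<beta>) * cmod ?g * cmod ?If =
          a ^ (1 + \<gamma>) * b ^ (2 + \<gamma> + \<beta>) * (a * cmod ?If) * cmod ?g"
        by (simp add: mult_ac)
      also have "\<dots> \<le> N i"
      proof (cases "b * \<bar>x2\<bar> \<le> 1 \<and> a * b * \<bar>x3\<bar> \<le> 1")
        case True
        have w: "a ^ (1 + \<gamma>) * b ^ (2 + \<gamma> + \<beta>) * trunc_pow 1 (a * t) \<le> E t * P t i" if "0 < t" for t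
        proof -
          have "2 / (\<bar>x2\<bar> ^ (\<beta> + 1) * \<bar>x3\<bar> ^ (\<gamma> + 1)) = 2 * D" by (simp add: D_def)
          moreover have "P t i = trunc_pow (1 - \<theta>) (a * t) * trunc_pow (1 - \<theta>) (b * \<bar>x2\<bar>)"
            by (simp add: P_def i a_def b_def)
          ultimately show ?thesis
            using dyadic_weight_trunc_le[OF ab that, of "\<bar>x2\<bar>" "\<bar>x3\<bar>" \<theta> \<gamma> \<beta>] True x \<theta>
            unfolding E_def by simp
        qed
        have "a ^ (1 + \<gamma>) * b ^ (2 + \<gamma> + \<beta>) * (a * cmod ?If) * cmod ?g \<le>
            a ^ (1 + \<gamma>) * b ^ (2 + \<gamma> + \<beta>) * (2 * F * (trunc_pow 1 (a * r) + trunc_pow 1 (a * \<delta>))) * G"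
          using ab G F(1) shell_integral_le[OF f F(2) mean pos ab(1)]
          by (intro mult_mono[OF mult_left_mono]) (auto simp: trunc_pow_nonneg)
        also have "\<dots> = 2 * F * G * (a ^ (1 + \<gamma>) * b ^ (2 + \<gamma> + \<beta>) * trunc_pow 1 (a * r) +
            a ^ (1 + \<gamma>) * b ^ (2 + \<gamma> + \<beta>) * trunc_pow 1 (a * \<delta>))"
          by (simp add: algebra_simps)
        also have "\<dots> \<le> N i"
          unfolding N_def using F(1) G(1) by (intro mult_left_mono add_mono w pos) auto
        finally show ?thesis .
      next
        case False
        hence "?g = 0" using ab by (intro bump_pair_eq_0[OF g]) (auto simp: abs_mult)
        thus ?thesis using bounded_sum_ge_0[OF N, of i] by simp
      qed
      finally show "cmod (LINT x1:?A|lborel. multiscale_term (2 + \<gamma>) (2 + \<gamma> + \<beta>) f g (x1, x2, x3) i) \<le> N i" .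
    qed
    also have "\<dots> = 2 * F * G * (2 * (c * c)) * D *
        ((r * \<bar>x2\<bar> / \<bar>x3\<bar> + \<bar>x3\<bar> / (r * \<bar>x2\<bar>)) powr (- \<theta>) + (\<delta> * \<bar>x2\<bar> / \<bar>x3\<bar> + \<bar>x3\<bar> / (\<delta> * \<bar>x2\<bar>)) powr (- \<theta>))"
      by (simp add: E_def algebra_simps)
    finally show "cmod (LINT x1:?A|lborel. multiscale_sum (2 + \<gamma>) (2 + \<gamma> + \<beta>) f g (x1, x2, x3)) \<le>
        2 * F * G * (2 * (c * c)) / (\<bar>x2\<bar> ^ (\<beta> + 1) * \<bar>x3\<bar> ^ (\<gamma> + 1)) *
        (1 / (\<bar>r * x2 / x3\<bar> + \<bar>x3 / (r * x2)\<bar>) powr \<theta> +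
         1 / (\<bar>\<delta> * x2 / x3\<bar> + \<bar>x3 / (\<delta> * x2)\<bar>) powr \<theta>)"
      using pos by (simp add: D_def abs_mult powr_minus_divide)
  qed
qed

text \<open>
  One factor \<open>a * b\<^sup>2\<close> of the weight normalises the integral over the plane, which is summable
  over \<open>k\<close> uniformly in \<open>j\<close>.  The remaining \<open>a ^ (\<alpha> + 1)\<close> is summed over \<open>a * \<bar>x1\<bar> \<le> 1\<close>.
\<close>

lemma multiscale_sum_plane_integral_bound:
  fixes f :: "real \<Rightarrow> complex" and g :: "real \<times> real \<Rightarrow> complex"
  assumes f: "bump f" and g: "bump g" and mean: "(LINT y|lborel. g y) = 0"
  shows "\<exists>C. \<forall>\<delta>1 \<delta>2 r1 r2 x1. 0 < \<delta>1 \<and> 0 < \<delta>2 \<and> 0 < r1 \<and> 0 < r2 \<and> x1 \<noteq> 0 \<longrightarrow>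
    cmod (LINT y:shell \<delta>1 r1 \<times> shell \<delta>2 r2|lborel. multiscale_sum (2 + \<alpha>) 2 f g (x1, y)) \<le> C / \<bar>x1\<bar> ^ (\<alpha> + 1)"
proof -
  obtain F where F: "0 < F" "\<And>x. cmod (f x) \<le> F" using bump_bounded[OF f] by blast
  obtain G where G: "0 < G" "\<And>x. cmod (g x) \<le> G" using bump_bounded[OF g] by blast
  obtain e :: "nat \<Rightarrow> int \<times> int" where e: "bij e" using ex_bij_nat_int_prod by blast
  define c c' where "c = dyadic_const 1" and "c' = dyadic_const (real (\<alpha> + 1))"
  show ?thesis
  proof (intro exI[of _ "F * (8 * G) * (c' * (c + c + c + c))"] allI impI)
    fix \<delta>1 \<delta>2 r1 r2 x1 :: real
    assume "0 < \<delta>1 \<and> 0 < \<delta>2 \<and> 0 < r1 \<and> 0 < r2 \<and> x1 \<noteq> 0"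
    hence pos: "0 < \<delta>1" "0 < r1" "0 < \<delta>2" "0 < r2" and x: "0 < \<bar>x1\<bar>" by auto
    let ?B = "shell \<delta>1 r1 \<times> shell \<delta>2 r2"
    have B: "?B \<in> sets borel" "emeasure lborel ?B < \<infinity>"
      by (intro Times_borel_finite shell_sets emeasure_shell)+
    obtain M C where M: "bounded_sum M C"
      "\<And>x i. \<bar>x1\<bar> \<le> \<bar>fst x\<bar> \<Longrightarrow> \<delta>1 \<le> \<bar>fst (snd x)\<bar> \<Longrightarrow> cmod (multiscale_term (2 + \<alpha>) 2 f g x i) \<le> M i"
      using multiscale_term_bounded_sum[OF f g, of "2 + \<alpha>" 2 "\<bar>x1\<bar>" \<delta>1] pos x by auto
    define X where "X j = trunc_pow (real (\<alpha> + 1)) (2 powi j * \<bar>x1\<bar>)" for j :: int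
    define Y where "Y j k = trunc_pow 1 (2 powi k * r1) + trunc_pow 1 (2 powi k * \<delta>1) +
       trunc_pow 1 (2 powi k * (2 powi j * r2)) + trunc_pow 1 (2 powi k * (2 powi j * \<delta>2))" for j k :: int
    define D where "D = F * (8 * G) / \<bar>x1\<bar> ^ (\<alpha> + 1)"
    have D: "0 \<le> D" using F(1) G(1) by (simp add: D_def)
    define N where "N = (\<lambda>i. D * (case i of (j, k) \<Rightarrow> X j * Y j k))"
    have "bounded_sum X c'" unfolding X_def c'_def using x by (intro bounded_sum_trunc_pow) auto
    moreover have "bounded_sum (Y j) (c + c + c + c)" for j
      unfolding Y_def c_def using pos by (intro bounded_sum_add bounded_sum_trunc_pow; simp)
    ultimately have N: "bounded_sum N (D * (c' * (c + c + c + c)))"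
      unfolding N_def by (intro bounded_sum_cmult bounded_sum_product D)
    have "cmod (LINT y:?B|lborel. multiscale_sum (2 + \<alpha>) 2 f g (x1, y)) \<le> D * (c' * (c + c + c + c))"
      unfolding multiscale_sum_def
    proof (rule norm_integral_infsum_le[OF e _ B(2) _ M(1) _ N])
      show "?B \<in> sets lborel" using B(1) by simp
      show "set_borel_measurable lborel ?B (\<lambda>y. multiscale_term (2 + \<alpha>) 2 f g (x1, y) i)" for i
        by (intro set_borel_measurable_continuous B(1)
            continuous_on_compose2[OF multiscale_term_continuous[OF f g]] continuous_intros) auto
      show "cmod (multiscale_term (2 + \<alpha>) 2 f g (x1, y) i) \<le> M i" if "y \<in> ?B" for i y
        using that by (intro M(2)) (auto simp: shell_def)
      fix i :: "int \<times> int"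
      obtain j k where i: "i = (j, k)" by (metis prod.exhaust)
      define a b :: real where "a = 2 powi j" and "b = 2 powi k"
      have ab: "0 < a" "0 < b" by (auto simp: a_def b_def)
      let ?Ig = "LINT y:?B|lborel. g (b * fst y, a * b * snd y)"
      have Y0: "0 \<le> Y j k" by (simp add: Y_def trunc_pow_nonneg)
      have "(LINT y:?B|lborel. multiscale_term (2 + \<alpha>) 2 f g (x1, y) i) =
          of_real (a ^ (2 + \<alpha>) * b ^ 2) * f (a * x1) * ?Ig"
        unfolding set_integral_mult_right[symmetric]
        by (simp add: multiscale_term_def i a_def b_def)
      hence "cmod (LINT y:?B|lborel. multiscale_term (2 + \<alpha>) 2 f g (x1, y) i) =
          cmod (of_real (a ^ (2 + \<alpha>) * b ^ 2)) * cmod (f (a * x1)) * cmod ?Ig"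
        by (simp only: norm_mult)
      also have "cmod (of_real (a ^ (2 + \<alpha>) * b ^ 2)) = a ^ (2 + \<alpha>) * b ^ 2"
        using ab by (simp only: norm_of_real) simp
      also have "a ^ (2 + \<alpha>) * b ^ 2 * cmod (f (a * x1)) * cmod ?Ig =
          a ^ (\<alpha> + 1) * cmod (f (a * x1)) * (b * (a * b) * cmod ?Ig)"
        by (simp add: power2_eq_square mult_ac)
      also have "\<dots> \<le> (F / \<bar>x1\<bar> ^ (\<alpha> + 1) * X j) * (8 * G * Y j k)"
      proof (rule mult_mono)
        show "a ^ (\<alpha> + 1) * cmod (f (a * x1)) \<le> F / \<bar>x1\<bar> ^ (\<alpha> + 1) * X j"
        proof (cases "a * \<bar>x1\<bar> \<le> 1")
          case True
          hence "X j = a ^ (\<alpha> + 1) * \<bar>x1\<bar> ^ (\<alpha> + 1)"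
            using ab x unfolding X_def a_def[symmetric] trunc_pow_def
            by (simp only: powr_realpow mult_pos_pos power_mult_distrib if_True)
          hence "F / \<bar>x1\<bar> ^ (\<alpha> + 1) * X j = a ^ (\<alpha> + 1) * F" using x by simp
          moreover have "a ^ (\<alpha> + 1) * cmod (f (a * x1)) \<le> a ^ (\<alpha> + 1) * F"
            using F(2)[of "a * x1"] ab by (intro mult_left_mono) auto
          ultimately show ?thesis by simp
        next
          case False
          hence "1 < norm (a * x1)" using ab by (simp add: abs_mult)
          hence "f (a * x1) = 0" using f by (simp add: bump_def)
          thus ?thesis using F(1) by (simp add: X_def trunc_pow_nonneg)
        qed
        have "b * (a * b) * cmod ?Ig \<le> 8 * G * (trunc_pow 1 (b * r1) + trunc_pow 1 (b * \<delta>1) +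
            trunc_pow 1 (a * b * r2) + trunc_pow 1 (a * b * \<delta>2))"
          using ab by (intro shell_integral_prod_le[OF g G(2) mean] pos) auto
        thus "b * (a * b) * cmod ?Ig \<le> 8 * G * Y j k"
          unfolding Y_def a_def[symmetric] b_def[symmetric] by (simp add: mult_ac)
      qed (use ab F(1) in \<open>auto simp: X_def trunc_pow_nonneg\<close>)
      also have "\<dots> = N i" by (simp add: N_def i D_def)
      finally show "cmod (LINT y:?B|lborel. multiscale_term (2 + \<alpha>) 2 f g (x1, y) i) \<le> N i" .
    qed
    thus "cmod (LINT y:?B|lborel. multiscale_sum (2 + \<alpha>) 2 f g (x1, y)) \<le> F * (8 * G) * (c' * (c + c + c + c)) / \<bar>x1\<bar> ^ (\<alpha> + 1)"
      by (simp add: D_def)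
  qed
qed

section \<open>The kernel estimates\<close>

lemma schwartz_supported_imp_bump:
  assumes "schwartz f" "closure {x. f x \<noteq> 0} \<subseteq> cball 0 1"
  shows "bump f"
proof -
  have "f x = 0" if "1 < norm x" for x
    using assms(2) closure_subset[of "{x. f x \<noteq> 0}"] that by force
  thus ?thesis using assms(1) by (simp add: bump_def schwartz_def)
qed

theorem theorem4p1:
  fixes \<phi>1 :: "real \<Rightarrow> complex" and \<phi>2 :: "real \<times> real \<Rightarrow> complex"
    and K :: "real \<times> real \<times> real \<Rightarrow> complex"
  assumes "schwartz \<phi>1" and "schwartz \<phi>2"
    and "closure {x. \<phi>1 x \<noteq> 0} \<subseteq> cball 0 1"
    and "closure {x. \<phi>2 x \<noteq> 0} \<subseteq> cball 0 1"
    and "\<And>\<xi>1. \<xi>1 \<noteq> 0 \<Longrightarrow>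
           ((\<lambda>j::int. (cmod (fourier \<phi>1 (2 powi j * \<xi>1)))\<^sup>2) has_sum 1) UNIV"
    and "\<And>\<xi>2 \<xi>3. (\<xi>2, \<xi>3) \<noteq> (0, 0) \<Longrightarrow>
           ((\<lambda>k::int. (cmod (fourier \<phi>2 (2 powi k * \<xi>2, 2 powi k * \<xi>3)))\<^sup>2) has_sum 1) UNIV"
    and "\<And>\<alpha>::nat. \<alpha> \<le> 10 \<Longrightarrow> (LINT x1|lborel. complex_of_real (x1 ^ \<alpha>) * \<phi>1 x1) = 0"
    and "\<And>\<beta> \<gamma>::nat. \<beta> \<le> 10 \<Longrightarrow> \<gamma> \<le> 10 \<Longrightarrow>
           (LINT (x2, x3)|lborel. complex_of_real (x2 ^ \<beta> * x3 ^ \<gamma>) * \<phi>2 (x2, x3)) = 0"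
  defines "K \<equiv> dyadic_kernel \<phi>1 \<phi>2"
  shows
    \<comment> \<open>the kernel is well defined and smooth off the coordinate planes\<close>
    "(\<forall>x1 x2 x3. x1 * x2 * x3 \<noteq> 0 \<longrightarrow> dyadic_term \<phi>1 \<phi>2 (x1, x2, x3) summable_on UNIV) \<and>
     smooth_on {(x1, x2, x3). x1 * x2 * x3 \<noteq> 0} K \<and>
     (\<forall>\<alpha> \<beta> \<gamma> \<theta>. 0 < \<theta> \<and> \<theta> < 1 \<longrightarrow>
       (\<exists>C. \<forall>x1 x2 x3. x1 * x2 * x3 \<noteq> 0 \<longrightarrow>
         cmod (partial3 \<alpha> \<beta> \<gamma> K (x1, x2, x3)) \<le>
           C / (\<bar>x1\<bar> ^ (\<alpha> + 1) * \<bar>x2\<bar> ^ (\<beta> + 1) * \<bar>x3\<bar> ^ (\<gamma> + 1)) *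
             (\<bar>x1 * x2 / x3\<bar> + \<bar>x3 / (x1 * x2)\<bar>) powr (- \<theta>))) \<and>
     (\<exists>C. \<forall>\<delta>1 \<delta>2 \<delta>3 r1 r2 r3.
         0 < \<delta>1 \<and> 0 < \<delta>2 \<and> 0 < \<delta>3 \<and> 0 < r1 \<and> 0 < r2 \<and> 0 < r3 \<longrightarrow>
         cmod (LINT x:shell \<delta>1 r1 \<times> shell \<delta>2 r2 \<times> shell \<delta>3 r3|lborel. K x) \<le> C) \<and>
     (\<forall>\<beta> \<gamma> \<theta>. 0 < \<theta> \<and> \<theta> < 1 \<longrightarrow>
       (\<exists>C. \<forall>\<delta> r x2 x3. 0 < \<delta> \<and> 0 < r \<and> x2 \<noteq> 0 \<and> x3 \<noteq> 0 \<longrightarrow>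
         cmod (LINT x1:shell \<delta> r|lborel. partial3 0 \<beta> \<gamma> K (x1, x2, x3)) \<le>
           C / (\<bar>x2\<bar> ^ (\<beta> + 1) * \<bar>x3\<bar> ^ (\<gamma> + 1)) *
             (1 / (\<bar>r * x2 / x3\<bar> + \<bar>x3 / (r * x2)\<bar>) powr \<theta> +
              1 / (\<bar>\<delta> * x2 / x3\<bar> + \<bar>x3 / (\<delta> * x2)\<bar>) powr \<theta>))) \<and>
     (\<forall>\<alpha>. \<exists>C. \<forall>\<delta>1 \<delta>2 r1 r2 x1.
         0 < \<delta>1 \<and> 0 < \<delta>2 \<and> 0 < r1 \<and> 0 < r2 \<and> x1 \<noteq> 0 \<longrightarrow>
         cmod (LINT (x2, x3):shell \<delta>1 r1 \<times> shell \<delta>2 r2|lborel. partial3 \<alpha> 0 0 K (x1, x2, x3)) \<le>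
           C / \<bar>x1\<bar> ^ (\<alpha> + 1))"
proof -
  have f: "bump \<phi>1" and g: "bump \<phi>2" using assms(1-4) by (auto intro: schwartz_supported_imp_bump)
  have meanf: "(LINT x|lborel. \<phi>1 x) = 0" using assms(7)[of 0] by simp
  have meang: "(LINT y|lborel. \<phi>2 y) = 0" using assms(8)[of 0 0] by simp
  have K: "K = multiscale_sum 2 2 \<phi>1 \<phi>2" by (simp add: K_def dyadic_kernel_eq_multiscale_sum)
  define f' where "f' \<alpha> = (partial_deriv 1 ^^ \<alpha>) \<phi>1" for \<alpha>
  define g' where "g' \<beta> \<gamma> = (partial_deriv (1, 0) ^^ \<beta>) ((partial_deriv (0, 1) ^^ \<gamma>) \<phi>2)" for \<beta> \<gamma>
  have f': "bump (f' \<alpha>)" for \<alpha>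
    using bump_partial_deriv_funpow[OF f, of 1] by (simp add: f'_def)
  have g': "bump (g' \<beta> \<gamma>)" for \<beta> \<gamma>
    unfolding g'_def by (rule bump_partial_deriv_funpow[OF bump_partial_deriv_funpow[OF g]]) (auto simp: Basis_prod_def)
  have pd: "partial3 \<alpha> \<beta> \<gamma> K (x1, x2, x3) = multiscale_sum (2 + \<gamma> + \<alpha>) (2 + \<gamma> + \<beta>) (f' \<alpha>) (g' \<beta> \<gamma>) (x1, x2, x3)"
    if "x1 * x2 * x3 \<noteq> 0" for \<alpha> \<beta> \<gamma> x1 x2 x3
    unfolding K f'_def g'_def by (rule partial3_multiscale_sum[OF f g]) (use that in \<open>auto simp: off_planes_def\<close>)
  have c1: "dyadic_term \<phi>1 \<phi>2 (x1, x2, x3) summable_on UNIV" if "x1 * x2 * x3 \<noteq> 0" for x1 x2 x3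
    unfolding dyadic_term_eq_multiscale_term using that by (intro multiscale_term_summable[OF f g]) auto
  have c2: "smooth_on {(x1, x2, x3). x1 * x2 * x3 \<noteq> 0} K"
    unfolding K using smooth_on_multiscale_sum[OF f g, of 2 2] by (simp add: off_planes_def)
  have c3: "\<exists>C. \<forall>x1 x2 x3. x1 * x2 * x3 \<noteq> 0 \<longrightarrow>
      cmod (partial3 \<alpha> \<beta> \<gamma> K (x1, x2, x3)) \<le>
        C / (\<bar>x1\<bar> ^ (\<alpha> + 1) * \<bar>x2\<bar> ^ (\<beta> + 1) * \<bar>x3\<bar> ^ (\<gamma> + 1)) *
          (\<bar>x1 * x2 / x3\<bar> + \<bar>x3 / (x1 * x2)\<bar>) powr (- \<theta>)"
    if "0 < \<theta> \<and> \<theta> < 1" for \<alpha> \<beta> \<gamma> \<theta>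
    using multiscale_sum_pointwise_bound[OF f' g' that[THEN conjunct1] that[THEN conjunct2], where \<alpha> = \<alpha> and \<beta> = \<beta> and \<gamma> = \<gamma>]
    by (metis (no_types, lifting) pd)
  have c4: "\<exists>C. \<forall>\<delta>1 \<delta>2 \<delta>3 r1 r2 r3.
      0 < \<delta>1 \<and> 0 < \<delta>2 \<and> 0 < \<delta>3 \<and> 0 < r1 \<and> 0 < r2 \<and> 0 < r3 \<longrightarrow>
      cmod (LINT x:shell \<delta>1 r1 \<times> shell \<delta>2 r2 \<times> shell \<delta>3 r3|lborel. K x) \<le> C"
    unfolding K by (rule multiscale_sum_box_integral_bound[OF f g meanf meang])
  have c5: "\<exists>C. \<forall>\<delta> r x2 x3. 0 < \<delta> \<and> 0 < r \<and> x2 \<noteq> 0 \<and> x3 \<noteq> 0 \<longrightarrow>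
      cmod (LINT x1:shell \<delta> r|lborel. partial3 0 \<beta> \<gamma> K (x1, x2, x3)) \<le>
        C / (\<bar>x2\<bar> ^ (\<beta> + 1) * \<bar>x3\<bar> ^ (\<gamma> + 1)) *
          (1 / (\<bar>r * x2 / x3\<bar> + \<bar>x3 / (r * x2)\<bar>) powr \<theta> +
           1 / (\<bar>\<delta> * x2 / x3\<bar> + \<bar>x3 / (\<delta> * x2)\<bar>) powr \<theta>)"
    if \<theta>: "0 < \<theta> \<and> \<theta> < 1" for \<beta> \<gamma> \<theta>
  proof -
    have eq: "(LINT x1:shell \<delta> r|lborel. partial3 0 \<beta> \<gamma> K (x1, x2, x3)) =
        (LINT x1:shell \<delta> r|lborel. multiscale_sum (2 + \<gamma>) (2 + \<gamma> + \<beta>) \<phi>1 (g' \<beta> \<gamma>) (x1, x2, x3))"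
      if "0 < \<delta>" "0 < r" "x2 \<noteq> 0" "x3 \<noteq> 0" for \<delta> r x2 x3
      using that shell_sets pd[of _ x2 x3 0 \<beta> \<gamma>]
      by (intro set_lebesgue_integral_cong) (auto simp: shell_def f'_def)
    obtain C where "\<forall>\<delta> r x2 x3. 0 < \<delta> \<and> 0 < r \<and> x2 \<noteq> 0 \<and> x3 \<noteq> 0 \<longrightarrow>
      cmod (LINT x1:shell \<delta> r|lborel. multiscale_sum (2 + \<gamma>) (2 + \<gamma> + \<beta>) \<phi>1 (g' \<beta> \<gamma>) (x1, x2, x3)) \<le>
        C / (\<bar>x2\<bar> ^ (\<beta> + 1) * \<bar>x3\<bar> ^ (\<gamma> + 1)) *
          (1 / (\<bar>r * x2 / x3\<bar> + \<bar>x3 / (r * x2)\<bar>) powr \<theta> +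
           1 / (\<bar>\<delta> * x2 / x3\<bar> + \<bar>x3 / (\<delta> * x2)\<bar>) powr \<theta>)"
      using multiscale_sum_line_integral_bound[OF f g' meanf \<theta>[THEN conjunct1] \<theta>[THEN conjunct2], of \<gamma> \<beta> \<beta> \<gamma>]
      by blast
    thus ?thesis by (intro exI[of _ C]) (simp only: eq simp_thms cong: imp_cong)
  qed
  have c6: "\<exists>C. \<forall>\<delta>1 \<delta>2 r1 r2 x1.
      0 < \<delta>1 \<and> 0 < \<delta>2 \<and> 0 < r1 \<and> 0 < r2 \<and> x1 \<noteq> 0 \<longrightarrow>
      cmod (LINT (x2, x3):shell \<delta>1 r1 \<times> shell \<delta>2 r2|lborel. partial3 \<alpha> 0 0 K (x1, x2, x3)) \<le>
        C / \<bar>x1\<bar> ^ (\<alpha> + 1)" for \<alpha>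
  proof -
    have eq: "(LINT (x2, x3):shell \<delta>1 r1 \<times> shell \<delta>2 r2|lborel. partial3 \<alpha> 0 0 K (x1, x2, x3)) =
        (LINT y:shell \<delta>1 r1 \<times> shell \<delta>2 r2|lborel. multiscale_sum (2 + \<alpha>) 2 (f' \<alpha>) \<phi>2 (x1, y))"
      if "0 < \<delta>1" "0 < \<delta>2" "0 < r1" "0 < r2" "x1 \<noteq> 0" for \<delta>1 \<delta>2 r1 r2 x1
      using that pd[of x1 _ _ \<alpha> 0 0] shell_nonzero[of _ \<delta>1 r1] shell_nonzero[of _ \<delta>2 r2]
      by (intro set_lebesgue_integral_cong) (auto simp: g'_def intro!: borel_Times)
    obtain C where "\<forall>\<delta>1 \<delta>2 r1 r2 x1. 0 < \<delta>1 \<and> 0 < \<delta>2 \<and> 0 < r1 \<and> 0 < r2 \<and> x1 \<noteq> 0 \<longrightarrow>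
        cmod (LINT y:shell \<delta>1 r1 \<times> shell \<delta>2 r2|lborel. multiscale_sum (2 + \<alpha>) 2 (f' \<alpha>) \<phi>2 (x1, y))
          \<le> C / \<bar>x1\<bar> ^ (\<alpha> + 1)"
      using multiscale_sum_plane_integral_bound[OF f' g meang, of \<alpha> \<alpha>] by blast
    thus ?thesis by (intro exI[of _ C]) (simp only: eq simp_thms cong: imp_cong)
  qed
  show ?thesis
    by (intro conjI allI impI; (rule c2 | rule c4 | rule c6 | (rule c1, assumption) | (rule c3, assumption) | (rule c5, assumption)))
qed

end
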